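(* Let $m\ge 3$ be an integer and let $\{\xi_n,\,n\ge 1\}$ be independent identically distributed real random variables with $E\xi_i=0$, variance $\sigma^2\in(0,\infty)$, distribution function $F$ and characteristic function $f$, such that the pseudomoments $\mu_k$, $k=3,\dots,m$, exist. Suppose that (i) $A=\int_{\mathbb{R}}|f(t)|\,dt<\infty$; (ii) $\mu_k=0$ for $k=3,\dots,m$, and $\nu_n(m)=\max\{\nu_n^{(1)}(m),\nu_n^{(2)}(m)\}<\frac12 e^{-3/2}$. Then, for all $n\ge 2$ (for which the bound on $\nu_n(m)$ in (ii) holds), $$\sup_{x\in\mathbb{R}}|\Phi_n(x)-\Phi(x)|\le 2C^{(1)}_m\frac{\nu_n^{(1)}(m)}{n^{\frac{m-1}{2}}}+2C^{(2)}_m\frac{\nu_n^{(2)}(m)}{n^{\frac{m-2}{2}}}+\frac{\sigma A}{\pi}\,b^{\,n-1}+\nu_n(m)\,\frac{4e^{3/2}}{\pi}\,\frac{e^{-n/2}}{n},$$ where $$C^{(1)}_m=\frac{12^{\frac{m+1}{2}}\,\Gamma\!\left(\frac{m+1}{2}\right)}{\pi\,(m+1)!},\qquad C^{(2)}_m=2C^{(1)}_{m-1}=\frac{2\cdot 12^{\frac m2}\,\Gamma\!\left(\frac m2\right)}{\pi\, m!},\qquad b=\exp\left\{-\frac{\pi^2}{24A^2\sigma^2(2+\pi)^2}\right\}<1.$$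
   Context: $\Phi$ is the standard normal distribution function and $\Phi_n$ is the distribution function of $S_n=(\sigma\sqrt n)^{-1}(\xi_1+\cdots+\xi_n)$. The characteristic function is $f(t)=E e^{it\xi_1}=\int_{\mathbb{R}}e^{itx}\,dF(x)$. Put $H(x)=F(\sigma x)-\Phi(x)$, i.e. $dH$ is the signed measure given by the law of $\xi_1/\sigma$ minus the standard normal law, and let $|dH|$ denote its total variation measure. The pseudomoments are $\mu_k=\int_{\mathbb{R}}x^k\,dH(x)$; their existence for $k\le m$ means that these integrals converge absolutely (equivalently, $E|\xi_1|^m<\infty$). The truncated pseudomoments are $$\nu_n^{(1)}(m)=\int_{|x|\le\sigma\sqrt n}|x|^{m+1}\,|dH(x)|,\qquad \nu_n^{(2)}(m)=\int_{|x|>\sigma\sqrt n}|x|^{m}\,|dH(x)|.$$ $\Gamma$ is the Gamma function. *)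

theory Defs
  imports "HOL-Probability.Probability"
begin

text \<open>A signed measure is given by a measurable space N (only its space and sigma-algebra are
  used) and a real-valued set function. The positive part of its Jordan decomposition takes A to the
  supremum of the values on measurable subsets of A; the empty set is one of them, so the clipping
  of negative values to 0 by the coercion ennreal does not change the supremum.\<close>

definition pos_variation :: "'a measure \<Rightarrow> ('a set \<Rightarrow> real) \<Rightarrow> 'a measure" where
  "pos_variation N \<nu> =
     measure_of (space N) (sets N) (\<lambda>A. SUP B\<in>{B \<in> sets N. B \<subseteq> A}. ennreal (\<nu> B))"

definition neg_variation :: "'a measure \<Rightarrow> ('a set \<Rightarrow> real) \<Rightarrow> 'a measure" where
  "neg_variation N \<nu> = pos_variation N (\<lambda>B. - \<nu> B)"

definition total_variation :: "'a measure \<Rightarrow> ('a set \<Rightarrow> real) \<Rightarrow> 'a measure" where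
  "total_variation N \<nu> =
     measure_of (space N) (sets N)
       (\<lambda>A. emeasure (pos_variation N \<nu>) A + emeasure (neg_variation N \<nu>) A)"

definition signed_integral :: "'a measure \<Rightarrow> ('a set \<Rightarrow> real) \<Rightarrow> ('a \<Rightarrow> real) \<Rightarrow> real" where
  "signed_integral N \<nu> g =
     integral\<^sup>L (pos_variation N \<nu>) g - integral\<^sup>L (neg_variation N \<nu>) g"

text \<open>\<^const>\<open>measure_of\<close> returns the null measure when its set function is not a measure. The next
  lemmas show that this does not happen for the difference of two finite measures.\<close>

lemma emeasure_pos_variation:
  assumes "finite_measure P" "finite_measure Q" "sets P = sets N" "sets Q = sets N" "A \<in> sets N"
  shows "emeasure (pos_variation N (\<lambda>B. measure P B - measure Q B)) A =
         (SUP B\<in>{B \<in> sets N. B \<subseteq> A}. ennreal (measure P B - measure Q B))"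
proof -
  interpret P: finite_measure P by fact
  interpret Q: finite_measure Q by fact
  define d where "d B = measure P B - measure Q B" for B
  obtain Y where Y: "Y \<in> sets P"
      and Y1: "\<And>X. X \<in> sets P \<Longrightarrow> X \<subseteq> Y \<Longrightarrow> emeasure Q X \<le> emeasure P X"
      and Y2: "\<And>X. X \<in> sets P \<Longrightarrow> X \<inter> Y = {} \<Longrightarrow> emeasure P X \<le> emeasure Q X"
    using finite_unsigned_Hahn_decomposition[OF assms(1,2)] assms(3,4) by metis
  have YN: "Y \<in> sets N" using Y assms(3) by simp
  have d1: "0 \<le> d X" if "X \<in> sets N" "X \<subseteq> Y" for X
    using Y1[of X] that assms(3) by (simp add: d_def P.emeasure_eq_measure Q.emeasure_eq_measure)
  have d2: "d X \<le> 0" if "X \<in> sets N" "X \<inter> Y = {}" for X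
    using Y2[of X] that assms(3) by (simp add: d_def P.emeasure_eq_measure Q.emeasure_eq_measure)
  have d_diff: "d X = d (X \<inter> Z) + d (X - Z)" if "X \<in> sets N" "Z \<in> sets N" for X Z
  proof -
    have X: "X = (X \<inter> Z) \<union> (X - Z)" by auto
    have disj: "(X \<inter> Z) \<inter> (X - Z) = {}" by auto
    have "measure P X = measure P (X \<inter> Z) + measure P (X - Z)"
      using P.finite_measure_Union[OF _ _ disj] that assms(3) X by auto
    moreover have "measure Q X = measure Q (X \<inter> Z) + measure Q (X - Z)"
      using Q.finite_measure_Union[OF _ _ disj] that assms(4) X by auto
    ultimately show ?thesis by (simp add: d_def)
  qed
  have sup: "(SUP B\<in>{B \<in> sets N. B \<subseteq> C}. ennreal (d B)) = ennreal (d (C \<inter> Y))"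
    if C: "C \<in> sets N" for C
  proof (rule antisym)
    show "(SUP B\<in>{B \<in> sets N. B \<subseteq> C}. ennreal (d B)) \<le> ennreal (d (C \<inter> Y))"
    proof (rule SUP_least)
      fix B assume "B \<in> {B \<in> sets N. B \<subseteq> C}"
      then have B: "B \<in> sets N" "B \<subseteq> C" by auto
      have "d (B - Y) \<le> 0" using B YN by (intro d2) auto
      moreover have "d ((C \<inter> Y) - B) \<ge> 0" using B C YN by (intro d1) auto
      moreover have "d B = d (B \<inter> Y) + d (B - Y)" by (rule d_diff[OF B(1) YN])
      moreover have "d (C \<inter> Y) = d (C \<inter> Y \<inter> B) + d (C \<inter> Y - B)"
        using C YN by (intro d_diff[OF _ B(1)]) auto
      moreover have "C \<inter> Y \<inter> B = B \<inter> Y" using B by auto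
      ultimately show "ennreal (d B) \<le> ennreal (d (C \<inter> Y))"
        by (intro ennreal_leI) simp
    qed
    show "ennreal (d (C \<inter> Y)) \<le> (SUP B\<in>{B \<in> sets N. B \<subseteq> C}. ennreal (d B))"
      using C YN by (intro SUP_upper) auto
  qed
  have "countably_additive (sets N) (\<lambda>C. SUP B\<in>{B \<in> sets N. B \<subseteq> C}. ennreal (d B))"
  proof (rule countably_additiveI)
    fix C :: "nat \<Rightarrow> 'a set"
    assume C: "range C \<subseteq> sets N" "disjoint_family C" "(\<Union>i. C i) \<in> sets N"
    have disj: "disjoint_family (\<lambda>i. C i \<inter> Y)"
      using C(2) by (auto simp: disjoint_family_on_def)
    have "(\<lambda>i. measure P (C i \<inter> Y)) sums measure P (\<Union>i. C i \<inter> Y)"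
      using C(1) YN assms(3) by (intro P.finite_measure_UNION disj) auto
    moreover have "(\<lambda>i. measure Q (C i \<inter> Y)) sums measure Q (\<Union>i. C i \<inter> Y)"
      using C(1) YN assms(4) by (intro Q.finite_measure_UNION disj) auto
    ultimately have "(\<lambda>i. d (C i \<inter> Y)) sums d (\<Union>i. C i \<inter> Y)"
      unfolding d_def by (rule sums_diff)
    moreover have "(\<Union>i. C i \<inter> Y) = (\<Union>i. C i) \<inter> Y" by auto
    moreover have "0 \<le> d (C i \<inter> Y)" for i using C(1) YN by (intro d1) auto
    ultimately have "(\<Sum>i. ennreal (d (C i \<inter> Y))) = ennreal (d ((\<Union>i. C i) \<inter> Y))"
      by (metis suminf_ennreal_eq)
    moreover have "C i \<in> sets N" for i using C(1) by auto
    ultimately show "(\<Sum>i. SUP B\<in>{B \<in> sets N. B \<subseteq> C i}. ennreal (d B)) =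
        (SUP B\<in>{B \<in> sets N. B \<subseteq> (\<Union>i. C i)}. ennreal (d B))"
      using sup C(3) by simp
  qed
  moreover have "positive (sets N) (\<lambda>C. SUP B\<in>{B \<in> sets N. B \<subseteq> C}. ennreal (d B))"
    using sup[of "{}"] by (simp add: positive_def d_def)
  ultimately show ?thesis
    using emeasure_measure_of_sigma[OF sets.sigma_algebra_axioms, of N _ A] assms(5)
    by (simp add: pos_variation_def d_def)
qed

lemma emeasure_neg_variation:
  assumes "finite_measure P" "finite_measure Q" "sets P = sets N" "sets Q = sets N" "A \<in> sets N"
  shows "emeasure (neg_variation N (\<lambda>B. measure P B - measure Q B)) A =
         (SUP B\<in>{B \<in> sets N. B \<subseteq> A}. ennreal (measure Q B - measure P B))"
  using emeasure_pos_variation[OF assms(2,1,4,3,5)] by (simp add: neg_variation_def)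

lemma sets_pos_variation [simp]: "sets (pos_variation N \<nu>) = sets N"
  by (simp add: pos_variation_def)

lemma sets_neg_variation [simp]: "sets (neg_variation N \<nu>) = sets N"
  by (simp add: neg_variation_def)

lemma sets_total_variation [simp]: "sets (total_variation N \<nu>) = sets N"
  by (simp add: total_variation_def)

lemma emeasure_total_variation:
  assumes "A \<in> sets N"
  shows "emeasure (total_variation N \<nu>) A =
         emeasure (pos_variation N \<nu>) A + emeasure (neg_variation N \<nu>) A"
proof (rule emeasure_measure_of[OF total_variation_def])
  show "countably_additive (sets (total_variation N \<nu>))
      (\<lambda>A. emeasure (pos_variation N \<nu>) A + emeasure (neg_variation N \<nu>) A)"
    by (rule countably_additiveI)
       (simp add: suminf_add[symmetric] suminf_emeasure)
qed (use assms in \<open>auto simp: positive_def sets.sets_into_space sets.space_closed\<close>)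

text \<open>Below, L is the law of the summands, so H is the distribution function of L rescaled by the
  standard deviation, minus the standard normal one; \<open>dH_atMost\<close> below states this.\<close>

definition dH :: "real measure \<Rightarrow> real \<Rightarrow> real set \<Rightarrow> real" where
  "dH L \<sigma> B = measure (distr L borel (\<lambda>x. x / \<sigma>)) B - measure std_normal_distribution B"

lemma dH_atMost:
  assumes "sets L = sets borel" "\<sigma> > 0"
  shows "dH L \<sigma> {..x} = cdf L (\<sigma> * x) - cdf std_normal_distribution x"
proof -
  have "space L = UNIV" using sets_eq_imp_space_eq[OF assms(1)] by simp
  moreover have "(\<lambda>x. x / \<sigma>) -` {..x} = {..\<sigma> * x}" using assms(2) by (auto simp: field_simps)
  moreover have "(\<lambda>x. x / \<sigma>) \<in> measurable L borel"
    by (subst measurable_cong_sets[OF assms(1) refl]) simp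
  ultimately show ?thesis by (simp add: dH_def cdf_def measure_distr)
qed

definition abs_dH :: "real measure \<Rightarrow> real \<Rightarrow> real measure" where
  "abs_dH L \<sigma> = total_variation borel (dH L \<sigma>)"

definition pseudomoment_exists :: "real measure \<Rightarrow> real \<Rightarrow> nat \<Rightarrow> bool" where
  "pseudomoment_exists L \<sigma> k \<longleftrightarrow> integrable (abs_dH L \<sigma>) (\<lambda>x. x ^ k)"

definition pseudomoment :: "real measure \<Rightarrow> real \<Rightarrow> nat \<Rightarrow> real" where
  "pseudomoment L \<sigma> k = signed_integral borel (dH L \<sigma>) (\<lambda>x. x ^ k)"

definition nu1 :: "real measure \<Rightarrow> real \<Rightarrow> nat \<Rightarrow> nat \<Rightarrow> real" where
  "nu1 L \<sigma> n m =
     set_lebesgue_integral (abs_dH L \<sigma>) {x. \<bar>x\<bar> \<le> \<sigma> * sqrt (real n)} (\<lambda>x. \<bar>x\<bar> ^ (m + 1))"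

definition nu2 :: "real measure \<Rightarrow> real \<Rightarrow> nat \<Rightarrow> nat \<Rightarrow> real" where
  "nu2 L \<sigma> n m =
     set_lebesgue_integral (abs_dH L \<sigma>) {x. \<bar>x\<bar> > \<sigma> * sqrt (real n)} (\<lambda>x. \<bar>x\<bar> ^ m)"

definition nu :: "real measure \<Rightarrow> real \<Rightarrow> nat \<Rightarrow> nat \<Rightarrow> real" where
  "nu L \<sigma> n m = max (nu1 L \<sigma> n m) (nu2 L \<sigma> n m)"

definition C1 :: "nat \<Rightarrow> real" where
  "C1 m = 12 powr ((real m + 1) / 2) * Gamma ((real m + 1) / 2) / (pi * fact (m + 1))"

definition C2 :: "nat \<Rightarrow> real" where
  "C2 m = 2 * 12 powr (real m / 2) * Gamma (real m / 2) / (pi * fact m)"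

lemma C2_eq_C1: "m \<ge> 1 \<Longrightarrow> C2 m = 2 * C1 (m - 1)"
  by (simp add: C1_def C2_def of_nat_diff)

end

(* Let P be the law of xi_1/sigma and g its characteristic function. All pseudomoments up to order m
   vanish, so Taylor's formula for exp(itx) under dH bounds |g(t) - exp(-t^2/2)| by
   |t|^(m+1) nu1 / (m+1)! + 2 |t|^m nu2 / m!. Levy's inversion formula bounds the distance of the
   distribution functions by (1/pi) times the integral of |g(t/sqrt n)^n - exp(-t^2/2)| / |t|, which
   is split at |t| = T sqrt n. Since nu is small, both characteristic functions are at most
   exp(-s^2/6) for |s| <= T, and the Taylor bound is integrated against exp(-t^2/12). Beyond that
   point |g| <= b, while T^2 = -ln(2 nu) - 1/2 makes the Gaussian tail proportional to nu; for
   nu = 0 let T tend to infinity.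

   The estimate |g(s)| <= b for |s| >= 1 uses the defect V = 1 - |g|^2, the variance of exp(isX):
   sqrt V is subadditive and sqrt (V u) <= |u|. If V(s) were too small, |g| would stay above 3/5 on
   unit intervals around 0, s, 2s, ..., N s, with N so large that the integral of |g| exceeds its
   value. *)

theory Submission
  imports Defs
begin

subsection \<open>Integrals with respect to the Jordan decomposition\<close>

text \<open>Subtraction in \<open>ennreal\<close> is truncated, so relations between signed measures
  are kept as equalities between sums of measures. Induction over nonnegative measurable functions
  carries such an equality from sets to integrals.\<close>

lemma nn_integral_add_measures:
  assumes sets: "sets M1 = sets N" "sets M2 = sets N" "sets M3 = sets N" "sets M4 = sets N"
    and eq: "\<And>A. A \<in> sets N \<Longrightarrow> emeasure M1 A + emeasure M2 A = emeasure M3 A + emeasure M4 A"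
    and g: "g \<in> borel_measurable N"
  shows "(\<integral>\<^sup>+x. g x \<partial>M1) + (\<integral>\<^sup>+x. g x \<partial>M2) = (\<integral>\<^sup>+x. g x \<partial>M3) + (\<integral>\<^sup>+x. g x \<partial>M4)"
proof -
  note [measurable_cong] = sets
  have sp: "space M1 = space N" "space M2 = space N" "space M3 = space N" "space M4 = space N"
    using sets by (auto dest: sets_eq_imp_space_eq)
  show ?thesis using g
  proof (induction rule: borel_measurable_induct)
    case (cong f g)
    have "(\<integral>\<^sup>+x. f x \<partial>M') = (\<integral>\<^sup>+x. g x \<partial>M')" if "space M' = space N" for M'
      using cong(3) that by (intro nn_integral_cong) auto
    with cong(4) sp show ?case by simp
  next
    case (set A)
    then show ?case using eq[of A] sets by simp
  next
    case (mult u c)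
    note [measurable] = \<open>u \<in> borel_measurable N\<close>
    show ?case using mult by (simp add: nn_integral_cmult flip: distrib_left)
  next
    case (add u v)
    note [measurable] = \<open>u \<in> borel_measurable N\<close> \<open>v \<in> borel_measurable N\<close>
    show ?case using add.IH by (simp add: nn_integral_add) (metis (no_types, lifting) add.assoc add.left_commute)
  next
    case (seq U)
    have [measurable]: "U i \<in> borel_measurable N" for i by (rule seq)
    have inc: "incseq (\<lambda>i. \<integral>\<^sup>+x. U i x \<partial>M')" for M'
      using seq(3) by (auto intro!: nn_integral_mono simp: incseq_def le_fun_def)
    have s: "(\<integral>\<^sup>+x. (SUP i. U i) x \<partial>M') = (SUP i. \<integral>\<^sup>+x. U i x \<partial>M')"
      if "sets M' = sets N" for M'
    proof -
      note [measurable_cong] = that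
      show ?thesis unfolding SUP_apply
        by (rule nn_integral_monotone_convergence_SUP) (use seq(3) in auto)
    qed
    show ?case
      by (simp only: s[OF sets(1)] s[OF sets(2)] s[OF sets(3)] s[OF sets(4)]
          ennreal_SUP_add[OF inc inc, symmetric] seq.IH)
  qed
qed

context
  fixes P Q N :: "'a measure"
  assumes fin: "finite_measure P" "finite_measure Q" and sets_PQ: "sets P = sets N" "sets Q = sets N"
begin

interpretation P: finite_measure P by (rule fin)
interpretation Q: finite_measure Q by (rule fin)

abbreviation (input) "diff_PQ \<equiv> (\<lambda>B. measure P B - measure Q B)"

text \<open>Write d = P - Q. For B inside A, d(B) + Q(A) = -d(A - B) + P(A), and -d(A - B) is one of
  the values whose supremum is the negative variation of A. One inequality is enough, since
  exchanging P and Q yields the reverse.\<close>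

lemma pos_variation_add_le:
  assumes A: "A \<in> sets N"
  shows "emeasure (pos_variation N diff_PQ) A + emeasure Q A \<le> emeasure (neg_variation N diff_PQ) A + emeasure P A"
proof -
  have nonempty: "{B \<in> sets N. B \<subseteq> A} \<noteq> {}" by auto
  have "emeasure (pos_variation N diff_PQ) A + emeasure Q A =
      (SUP B\<in>{B \<in> sets N. B \<subseteq> A}. ennreal (diff_PQ B) + emeasure Q A)"
    by (simp add: emeasure_pos_variation[OF fin sets_PQ A] ennreal_SUP_add_left[OF nonempty])
  also have "\<dots> \<le> emeasure (neg_variation N diff_PQ) A + emeasure P A"
  proof (rule SUP_least)
    fix B assume "B \<in> {B \<in> sets N. B \<subseteq> A}"
    then have B: "B \<in> sets N" "B \<subseteq> A" by auto
    have up: "ennreal (- diff_PQ C) \<le> emeasure (neg_variation N diff_PQ) A" if "C \<in> sets N" "C \<subseteq> A" for C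
      unfolding emeasure_neg_variation[OF fin sets_PQ A]
      using that by (intro SUP_upper2[of C]) auto
    have "diff_PQ (A - B) = diff_PQ A - diff_PQ B"
      using A B sets_PQ by (simp add: P.finite_measure_Diff Q.finite_measure_Diff)
    then have l1: "ennreal (diff_PQ B - diff_PQ A) \<le> emeasure (neg_variation N diff_PQ) A"
      using up[of "A - B"] A B by auto
    \<comment> \<open>This bound serves the case d(B) < 0: there \<open>ennreal\<close> clips d(B)
      to 0, and what remains is Q(A) = -d(A) + P(A).\<close>
    have l2: "ennreal (- diff_PQ A) \<le> emeasure (neg_variation N diff_PQ) A" using up[of A] A by auto
    have subadd: "ennreal (x + y) \<le> ennreal x + ennreal y" if "0 \<le> y" for x y
      using that by (auto simp: ennreal_plus_if intro!: ennreal_leI)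
    have "ennreal (diff_PQ B) + ennreal (measure Q A) =
        (if 0 \<le> diff_PQ B then ennreal ((diff_PQ B - diff_PQ A) + measure P A) else ennreal (- diff_PQ A + measure P A))"
      by (auto simp: ennreal_neg algebra_simps simp flip: ennreal_plus)
    also have "\<dots> \<le> emeasure (neg_variation N diff_PQ) A + ennreal (measure P A)"
      using order.trans[OF subadd[of "measure P A" "diff_PQ B - diff_PQ A"] add_right_mono[OF l1]]
        order.trans[OF subadd[of "measure P A" "- diff_PQ A"] add_right_mono[OF l2]]
      by (auto split: if_splits)
    finally show "ennreal (diff_PQ B) + emeasure Q A \<le> emeasure (neg_variation N diff_PQ) A + emeasure P A"
      by (simp add: P.emeasure_eq_measure Q.emeasure_eq_measure)
  qed
  finally show ?thesis .
qed

lemma finite_measure_pos_variation: "finite_measure (pos_variation N diff_PQ)"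
proof (rule finite_measureI)
  have sp: "space (pos_variation N diff_PQ) = space N" by (rule sets_eq_imp_space_eq) simp
  have "emeasure (pos_variation N diff_PQ) (space N) \<le> emeasure P (space N)"
    unfolding emeasure_pos_variation[OF fin sets_PQ sets.top]
  proof (rule SUP_least)
    fix B assume "B \<in> {B \<in> sets N. B \<subseteq> space N}"
    then have "measure P B \<le> measure P (space N)"
      using sets_PQ by (intro P.finite_measure_mono) auto
    then show "ennreal (diff_PQ B) \<le> emeasure P (space N)"
      unfolding P.emeasure_eq_measure by (intro ennreal_leI) (smt (verit) measure_nonneg)
  qed
  also have "\<dots> < \<infinity>" by (simp add: P.emeasure_eq_measure)
  finally show "emeasure (pos_variation N diff_PQ) (space (pos_variation N diff_PQ)) \<noteq> \<infinity>"
    using sp by auto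
qed

end

text \<open>This is the Jordan decomposition, positive part minus negative part equals P - Q, in a
  form free of subtraction. Exchanging P and Q swaps the two variations, so both inequalities come
  from \<open>pos_variation_add_le\<close>.\<close>

lemma variation_balance:
  fixes P Q N :: "'a measure"
  assumes fin: "finite_measure P" "finite_measure Q" and sets_PQ: "sets P = sets N" "sets Q = sets N"
    and A: "A \<in> sets N"
  shows "emeasure (pos_variation N (\<lambda>B. measure P B - measure Q B)) A + emeasure Q A =
    emeasure (neg_variation N (\<lambda>B. measure P B - measure Q B)) A + emeasure P A"
  using pos_variation_add_le[OF fin sets_PQ A] pos_variation_add_le[OF fin(2,1) sets_PQ(2,1) A]
  by (auto simp: neg_variation_def intro: antisym)

context
  fixes P Q N :: "'a measure"
  assumes fin: "finite_measure P" "finite_measure Q" and sets_PQ: "sets P = sets N" "sets Q = sets N"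
begin

abbreviation (input) "pos_PQ \<equiv> pos_variation N (\<lambda>B. measure P B - measure Q B)"
abbreviation (input) "neg_PQ \<equiv> neg_variation N (\<lambda>B. measure P B - measure Q B)"
abbreviation (input) "tot_PQ \<equiv> total_variation N (\<lambda>B. measure P B - measure Q B)"

lemma finite_measure_neg_variation: "finite_measure neg_PQ"
  using finite_measure_pos_variation[OF fin(2,1) sets_PQ(2,1)] by (simp add: neg_variation_def)

lemma nn_integral_total_variation:
  assumes [measurable]: "g \<in> borel_measurable N"
  shows "(\<integral>\<^sup>+x. g x \<partial>tot_PQ) = (\<integral>\<^sup>+x. g x \<partial>pos_PQ) + (\<integral>\<^sup>+x. g x \<partial>neg_PQ)"
  \<comment> \<open>The null measure fills the fourth place of the balance equation.\<close>
  using nn_integral_add_measures[of tot_PQ N "null_measure N" pos_PQ neg_PQ g]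
  by (simp add: emeasure_total_variation)

lemma integrable_total_variation_iff:
  fixes g :: "'a \<Rightarrow> 'b::{banach, second_countable_topology}"
  assumes [measurable]: "g \<in> borel_measurable N"
  shows "integrable tot_PQ g \<longleftrightarrow> integrable pos_PQ g \<and> integrable neg_PQ g"
proof -
  have m: "g \<in> borel_measurable M'" if "sets M' = sets N" for M'
    using assms measurable_cong_sets[OF that refl] by blast
  show ?thesis by (simp add: integrable_iff_bounded m nn_integral_total_variation)
qed

lemma integral_total_variation:
  fixes g :: "'a \<Rightarrow> real"
  assumes [measurable]: "g \<in> borel_measurable N" and g: "integrable tot_PQ g" "\<And>x. 0 \<le> g x"
  shows "integral\<^sup>L tot_PQ g = integral\<^sup>L pos_PQ g + integral\<^sup>L neg_PQ g"
proof -
  have i: "integrable pos_PQ g" "integrable neg_PQ g"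
    using g integrable_total_variation_iff[of g] by auto
  have "ennreal (integral\<^sup>L tot_PQ g) = (\<integral>\<^sup>+x. g x \<partial>pos_PQ) + (\<integral>\<^sup>+x. g x \<partial>neg_PQ)"
    using g by (simp add: nn_integral_eq_integral nn_integral_total_variation flip: nn_integral_eq_integral)
  also have "\<dots> = ennreal (integral\<^sup>L pos_PQ g + integral\<^sup>L neg_PQ g)"
    using i g(2) by (simp add: nn_integral_eq_integral integral_nonneg_AE flip: ennreal_plus)
  finally show ?thesis
    using g(2) by (subst (asm) ennreal_inj) (auto intro!: add_nonneg_nonneg integral_nonneg_AE)
qed

text \<open>Integrability under all four measures makes every term of the balance equation finite,
  so it can be rearranged into real differences. Real and complex integrands are then reduced to
  this case by positive and negative parts and by real and imaginary parts.\<close>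

lemma integral_variation_diff_nonneg:
  fixes g :: "'a \<Rightarrow> real"
  assumes g [measurable]: "g \<in> borel_measurable N" and nn: "\<And>x. 0 \<le> g x"
    and i: "integrable pos_PQ g" "integrable neg_PQ g" "integrable P g" "integrable Q g"
  shows "integral\<^sup>L pos_PQ g - integral\<^sup>L neg_PQ g = integral\<^sup>L P g - integral\<^sup>L Q g"
proof -
  have "(\<integral>\<^sup>+x. g x \<partial>pos_PQ) + (\<integral>\<^sup>+x. g x \<partial>Q) = (\<integral>\<^sup>+x. g x \<partial>neg_PQ) + (\<integral>\<^sup>+x. g x \<partial>P)"
    using variation_balance[OF fin sets_PQ] sets_PQ
    by (intro nn_integral_add_measures[where N=N]) auto
  then have "ennreal (integral\<^sup>L pos_PQ g + integral\<^sup>L Q g) = ennreal (integral\<^sup>L neg_PQ g + integral\<^sup>L P g)"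
    using i nn by (simp add: nn_integral_eq_integral integral_nonneg_AE)
  then show ?thesis
    using nn by (subst (asm) ennreal_inj) (auto intro!: add_nonneg_nonneg integral_nonneg_AE)
qed

lemma integral_variation_diff_real:
  fixes g :: "'a \<Rightarrow> real"
  assumes g [measurable]: "g \<in> borel_measurable N"
    and i: "integrable pos_PQ g" "integrable neg_PQ g" "integrable P g" "integrable Q g"
  shows "integral\<^sup>L pos_PQ g - integral\<^sup>L neg_PQ g = integral\<^sup>L P g - integral\<^sup>L Q g"
proof -
  have split: "integral\<^sup>L M' g = integral\<^sup>L M' (\<lambda>x. max 0 (g x)) - integral\<^sup>L M' (\<lambda>x. max 0 (- g x))"
    if "integrable M' g" for M'
  proof -
    have "g x = max 0 (g x) - max 0 (- g x)" for x by simp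
    then show ?thesis
      using that by (subst Bochner_Integration.integral_diff[symmetric]) auto
  qed
  show ?thesis
    using integral_variation_diff_nonneg[of "\<lambda>x. max 0 (g x)"]
      integral_variation_diff_nonneg[of "\<lambda>x. max 0 (- g x)"] i
    by (simp add: split)
qed

lemma integral_variation_diff_complex:
  fixes g :: "'a \<Rightarrow> complex"
  assumes g [measurable]: "g \<in> borel_measurable N"
    and i: "integrable pos_PQ g" "integrable neg_PQ g" "integrable P g" "integrable Q g"
  shows "integral\<^sup>L pos_PQ g - integral\<^sup>L neg_PQ g = integral\<^sup>L P g - integral\<^sup>L Q g"
  using integral_variation_diff_real[of "\<lambda>x. Re (g x)"]
    integral_variation_diff_real[of "\<lambda>x. Im (g x)"] i
  by (simp add: complex_eq_iff integral_Re integral_Im integrable_Re integrable_Im)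

end

section \<open>Taylor comparison of characteristic functions with matching moments\<close>

lemma integrable_power_mono:
  fixes M' :: "real measure"
  assumes le: "k \<le> m" and fin: "finite_measure M'" and sets: "sets M' = sets borel"
    and m: "integrable M' (\<lambda>x. x ^ m)"
  shows "integrable M' (\<lambda>x. x ^ k)"
proof -
  interpret finite_measure M' by (rule fin)
  note [measurable_cong] = sets
  have "\<bar>x ^ k\<bar> \<le> 1 + \<bar>x ^ m\<bar>" for x :: real
  proof (cases "\<bar>x\<bar> \<le> 1")
    case True
    then show ?thesis using power_le_one[of "\<bar>x\<bar>" k] by (simp add: power_abs add_increasing2)
  next
    case False
    then have "\<bar>x\<bar> ^ k \<le> \<bar>x\<bar> ^ m" using le by (intro power_increasing) auto
    then show ?thesis by (simp add: power_abs)
  qed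
  then have nb: "norm (x ^ k) \<le> norm (1 + \<bar>x ^ m\<bar>)" for x :: real
    unfolding real_norm_def by (rule order.trans[OF _ abs_ge_self])
  have ib: "integrable M' (\<lambda>x. 1 + \<bar>x ^ m\<bar>)"
    by (intro Bochner_Integration.integrable_add integrable_abs m) simp
  show ?thesis
    by (rule Bochner_Integration.integrable_bound[OF ib _ AE_I2[OF nb]]) measurable
qed

text \<open>The Taylor polynomial of degree m of exp(itx) has the same integral under both
  variations, so only its remainder \<open>r\<close> contributes. The remainder has two bounds,
  |tx|^(m+1)/(m+1)! and 2|tx|^m/m!; the first is used for |x| <= R and the second for |x| > R, where
  only the moment of order m is known to be finite.\<close>

lemma cmod_char_diff_le:
  fixes P Q :: "real measure" and t R :: real and m :: nat
  defines "pv \<equiv> pos_variation borel (\<lambda>B. measure P B - measure Q B)"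
    and "nv \<equiv> neg_variation borel (\<lambda>B. measure P B - measure Q B)"
    and "tv \<equiv> total_variation borel (\<lambda>B. measure P B - measure Q B)"
  assumes P: "real_distribution P" and Q: "real_distribution Q"
    and int: "integrable tv (\<lambda>x. x ^ m)"
    and mom: "\<And>k. k \<le> m \<Longrightarrow> (\<integral>x. x ^ k \<partial>pv) = (\<integral>x. x ^ k \<partial>nv)"
  shows "cmod (char P t - char Q t) \<le>
    \<bar>t\<bar> ^ (m + 1) / fact (m + 1) * set_lebesgue_integral tv {x. \<bar>x\<bar> \<le> R} (\<lambda>x. \<bar>x\<bar> ^ (m + 1)) +
    2 * \<bar>t\<bar> ^ m / fact m * set_lebesgue_integral tv {x. \<bar>x\<bar> > R} (\<lambda>x. \<bar>x\<bar> ^ m)"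
proof -
  interpret P: real_distribution P by (rule P)
  interpret Q: real_distribution Q by (rule Q)
  note PQ = P.finite_measure_axioms Q.finite_measure_axioms P.events_eq_borel Q.events_eq_borel
  note tv_iff = integrable_total_variation_iff[OF PQ, folded pv_def nv_def tv_def]
  have [measurable_cong]: "sets pv = sets borel" "sets nv = sets borel" "sets tv = sets borel"
    by (simp_all add: pv_def nv_def tv_def)
  interpret pv: finite_measure pv unfolding pv_def by (rule finite_measure_pos_variation[OF PQ])
  interpret nv: finite_measure nv unfolding nv_def by (rule finite_measure_neg_variation[OF PQ])
  have pm: "integrable pv (\<lambda>x. x ^ m)" "integrable nv (\<lambda>x. x ^ m)"
    using int by (simp_all add: tv_iff)
  define T where "T x = (\<Sum>k\<le>m. (\<i> * of_real (t * x)) ^ k / fact k)" for x :: real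
  define r where "r x = iexp (t * x) - T x" for x :: real
  have T_eq: "T x = (\<Sum>k\<le>m. ((\<i> * of_real t) ^ k / fact k) * of_real (x ^ k))" for x
    unfolding T_def by (intro sum.cong) (auto simp: power_mult_distrib)
  have iexp_int: "integrable M' (\<lambda>x. iexp (t * x))" if "finite_measure M'" "sets M' = sets borel" for M'
  proof -
    interpret finite_measure M' by fact
    note [measurable_cong] = that(2)
    show ?thesis by (rule integrable_const_bound[of _ 1]) auto
  qed
  have Tint: "integrable M' T" "integral\<^sup>L M' T = (\<Sum>k\<le>m. ((\<i> * of_real t) ^ k / fact k) * of_real (\<integral>x. x ^ k \<partial>M'))"
    if "finite_measure M'" "sets M' = sets borel" "integrable M' (\<lambda>x. x ^ m)" for M'
  proof -
    have i: "integrable M' (\<lambda>x. complex_of_real (x ^ k))" if "k \<le> m" for k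
      using integrable_power_mono[OF that \<open>finite_measure M'\<close>] \<open>sets M' = sets borel\<close> \<open>integrable M' (\<lambda>x. x ^ m)\<close>
      by (intro integrable_of_real) auto
    show "integrable M' T" unfolding T_eq[abs_def] using i by (intro Bochner_Integration.integrable_sum integrable_mult_right) auto
    show "integral\<^sup>L M' T = (\<Sum>k\<le>m. ((\<i> * of_real t) ^ k / fact k) * of_real (\<integral>x. x ^ k \<partial>M'))"
      unfolding T_eq[abs_def] using i
      by (subst Bochner_Integration.integral_sum) (auto intro!: sum.cong simp: integral_complex_of_real simp del: of_real_power)
  qed
  have fin: "finite_measure pv" "finite_measure nv" by unfold_locales
  have s: "sets pv = sets borel" "sets nv = sets borel" by (simp_all add: pv_def nv_def)
  note pT = Tint[OF fin(1) s(1) pm(1)] and nT = Tint[OF fin(2) s(2) pm(2)]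
  note pI = iexp_int[OF fin(1) s(1)] and nI = iexp_int[OF fin(2) s(2)]
  have ri: "integrable pv r" "integrable nv r"
    unfolding r_def using pT nT pI nI by auto
  have [measurable]: "r \<in> borel_measurable borel" unfolding r_def T_def by measurable
  have rtv: "integrable tv (\<lambda>x. cmod (r x))"
    using ri by (subst tv_iff) auto
  \<comment> \<open>Moments of order m + 1 need not exist, but on |x| <= R the power is bounded and
    the measures are finite.\<close>
  have bdd: "integrable M' (\<lambda>x. indicator {x. \<bar>x\<bar> \<le> R} x *\<^sub>R \<bar>x\<bar> ^ (m + 1))"
    if "finite_measure M'" "sets M' = sets borel" for M'
  proof -
    interpret finite_measure M' by fact
    note [measurable_cong] = that(2)
    have "\<bar>x\<bar> ^ (m + 1) \<le> \<bar>R\<bar> ^ (m + 1)" if "\<bar>x\<bar> \<le> R" for x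
      using that by (intro power_mono) auto
    then have "norm (indicator {x. \<bar>x\<bar> \<le> R} x *\<^sub>R \<bar>x\<bar> ^ (m + 1)) \<le> \<bar>R\<bar> ^ (m + 1)" for x
      by (cases "\<bar>x\<bar> \<le> R") (simp_all del: power_Suc)
    then show ?thesis
      by (intro integrable_const_bound[of _ "\<bar>R\<bar> ^ (m + 1)"] AE_I2) measurable
  qed
  have I1: "integrable tv (\<lambda>x. indicator {x. \<bar>x\<bar> \<le> R} x *\<^sub>R \<bar>x\<bar> ^ (m + 1))"
    using bdd[OF fin(1) s(1)] bdd[OF fin(2) s(2)] by (subst tv_iff) auto
  have I2: "integrable tv (\<lambda>x. indicator {x. \<bar>x\<bar> > R} x *\<^sub>R \<bar>x\<bar> ^ m)"
    by (rule Bochner_Integration.integrable_bound[OF int]) (auto simp: indicator_def power_abs)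
  have "char P t - char Q t = (CLINT x|pv. iexp (t * x)) - (CLINT x|nv. iexp (t * x))"
    unfolding char_def pv_def nv_def
    by (rule integral_variation_diff_complex[OF PQ, symmetric])
      (use pI nI P.integrable_iexp Q.integrable_iexp in \<open>auto simp: pv_def nv_def\<close>)
  also have "\<dots> = integral\<^sup>L pv r - integral\<^sup>L nv r"
    unfolding r_def using pT nT pI nI by (simp add: mom)
  finally have "cmod (char P t - char Q t) \<le> cmod (integral\<^sup>L pv r) + cmod (integral\<^sup>L nv r)"
    using norm_triangle_ineq4 by metis
  also have "\<dots> \<le> (\<integral>x. cmod (r x) \<partial>pv) + (\<integral>x. cmod (r x) \<partial>nv)"
    by (intro add_mono integral_norm_bound)
  also have "\<dots> = (\<integral>x. cmod (r x) \<partial>tv)"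
    using rtv by (intro integral_total_variation[OF PQ, folded pv_def nv_def tv_def, symmetric]) auto
  also have "\<dots> \<le> (\<integral>x. \<bar>t\<bar> ^ (m + 1) / fact (m + 1) * (indicator {x. \<bar>x\<bar> \<le> R} x *\<^sub>R \<bar>x\<bar> ^ (m + 1)) +
    2 * \<bar>t\<bar> ^ m / fact m * (indicator {x. \<bar>x\<bar> > R} x *\<^sub>R \<bar>x\<bar> ^ m) \<partial>tv)"
  proof (rule integral_mono)
    show "integrable tv (\<lambda>x. cmod (r x))"
      by (rule rtv)
    show "integrable tv (\<lambda>x. \<bar>t\<bar> ^ (m + 1) / fact (m + 1) * (indicator {x. \<bar>x\<bar> \<le> R} x *\<^sub>R \<bar>x\<bar> ^ (m + 1)) +
      2 * \<bar>t\<bar> ^ m / fact m * (indicator {x. \<bar>x\<bar> > R} x *\<^sub>R \<bar>x\<bar> ^ m))"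
      by (intro Bochner_Integration.integrable_add integrable_mult_right I1 I2)
    fix x
    \<comment> \<open>\<open>iexp_approx1\<close> is the bound of order m + 1, for small |x|;
      \<open>iexp_approx2\<close> is the bound of order m, for large |x|.\<close>
    show "cmod (r x) \<le> \<bar>t\<bar> ^ (m + 1) / fact (m + 1) * (indicator {x. \<bar>x\<bar> \<le> R} x *\<^sub>R \<bar>x\<bar> ^ (m + 1)) +
      2 * \<bar>t\<bar> ^ m / fact m * (indicator {x. \<bar>x\<bar> > R} x *\<^sub>R \<bar>x\<bar> ^ m)"
      using iexp_approx1[of "t * x" m] iexp_approx2[of "t * x" m]
      by (cases "\<bar>x\<bar> \<le> R") (simp_all add: r_def T_def abs_mult power_mult_distrib mult_ac del: fact_Suc)
  qed
  also have "\<dots> = \<bar>t\<bar> ^ (m + 1) / fact (m + 1) * set_lebesgue_integral tv {x. \<bar>x\<bar> \<le> R} (\<lambda>x. \<bar>x\<bar> ^ (m + 1)) +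
    2 * \<bar>t\<bar> ^ m / fact m * set_lebesgue_integral tv {x. \<bar>x\<bar> > R} (\<lambda>x. \<bar>x\<bar> ^ m)"
    unfolding set_lebesgue_integral_def
    by (subst Bochner_Integration.integral_add[OF integrable_mult_right[OF I1] integrable_mult_right[OF I2]])
      (simp only: integral_mult_right_zero)
  finally show ?thesis .
qed

subsection \<open>Distribution functions from characteristic functions\<close>

text \<open>In Levy's inversion formula for an interval (a, b] the kernel is at most 2/|t|, which
  cancels the factor |t| of the hypothesis; with the prefactor 1/(2 pi) this leaves (1/pi) times the
  integral of \<open>W\<close>. Then a tends to minus infinity and b decreases to x.\<close>

lemma real_distribution_cdf_diff_le:
  fixes F G :: "real measure" and W :: "real \<Rightarrow> real"
  assumes F: "real_distribution F" and G: "real_distribution G"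
    and W: "integrable lborel W"
    and bound: "\<And>t. cmod (char F t - char G t) \<le> \<bar>t\<bar> * W t"
  shows "\<bar>cdf F x - cdf G x\<bar> \<le> (\<integral>t. W t \<partial>lborel) / pi"
proof -
  interpret F: real_distribution F by (rule F)
  interpret G: real_distribution G by (rule G)
  \<comment> \<open>At t = 0 the hypothesis says nothing about \<open>W\<close>, so all comparisons
    with \<open>W\<close> below hold almost everywhere.\<close>
  have W_nonneg: "0 \<le> W t" if "t \<noteq> 0" for t
    using order.trans[OF norm_ge_zero bound[of t]] that by (simp add: zero_le_mult_iff)
  have AE0: "AE t in lborel. t \<noteq> (0::real)"
    by (rule AE_lborel_singleton)
  have Ioc: "\<bar>measure F {a<..b} - measure G {a<..b}\<bar> \<le> (\<integral>t. W t \<partial>lborel) / pi"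
    if "a \<le> b" "measure F {a} = 0" "measure F {b} = 0" "measure G {a} = 0" "measure G {b} = 0" for a b
  proof -
    define K where "K t = (iexp (-(t * a)) - iexp (-(t * b))) / (\<i> * t)" for t :: real
    have K1: "cmod (K t) \<le> b - a" if "t \<noteq> 0" for t
      using Levy_Inversion_aux2[of "-b" "-a" t] \<open>a \<le> b\<close> that by (simp add: K_def)
    \<comment> \<open>At t = 0 both sides vanish, since division by 0 yields 0. The bound
      \<open>K1\<close> secures integrability on bounded intervals; \<open>K2\<close> is the one
      that enters the estimate.\<close>
    have K2: "cmod (K t) \<le> 2 / \<bar>t\<bar>" for t
    proof -
      have "cmod (iexp (-(t * a)) - iexp (-(t * b))) \<le> 2"
        using norm_triangle_ineq4[of "iexp (-(t * a))" "iexp (-(t * b))"] by simp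
      then show ?thesis by (simp add: K_def norm_divide norm_mult divide_right_mono)
    qed
    have [measurable]: "K \<in> borel_measurable borel" unfolding K_def by measurable
    have int: "interval_lebesgue_integrable lborel (ereal (- T)) (ereal T) (\<lambda>t. K t * \<phi> t)"
      if [measurable]: "\<phi> \<in> borel_measurable borel" and le: "\<And>t. cmod (\<phi> t) \<le> 1" and T: "0 \<le> T"
      for \<phi> :: "real \<Rightarrow> complex" and T
    proof -
      have "AE t in lborel. norm (indicator {-T<..<T} t *\<^sub>R (K t * \<phi> t)) \<le> norm (indicator {-T<..<T} t *\<^sub>R (b - a))"
        using AE0
      proof eventually_elim
        case (elim t)
        then show ?case using K1[of t] le[of t] mult_mono[of "cmod (K t)" "b - a" "cmod (\<phi> t)" 1] \<open>a \<le> b\<close>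
          by (auto simp: indicator_def norm_mult)
      qed
      moreover have "integrable lborel (\<lambda>t. indicator {-T<..<T} t *\<^sub>R (b - a))"
        using T by (intro integrable_scaleR_left) (simp add: integrable_indicator_iff)
      ultimately have "integrable lborel (\<lambda>t. indicator {-T<..<T} t *\<^sub>R (K t * \<phi> t))"
        by (rule Bochner_Integration.integrable_bound[rotated 2]) measurable
      then show ?thesis using T
        by (simp add: interval_lebesgue_integrable_def set_integrable_def)
    qed
    define I where "I T = (CLBINT t=-T..T. K t * char F t) - (CLBINT t=-T..T. K t * char G t)" for T :: real
    note inv = F.Levy_Inversion[OF that(1,2,3), folded K_def] G.Levy_Inversion[OF that(1,4,5), folded K_def]
    have "(\<lambda>n. 1 / (2 * pi) * (CLBINT t=-real n..real n. K t * char F t) -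
        1 / (2 * pi) * (CLBINT t=-real n..real n. K t * char G t)) \<longlonglongrightarrow>
        complex_of_real (measure F {a<..b}) - complex_of_real (measure G {a<..b})"
      using tendsto_diff[OF inv] by simp
    then have lim: "(\<lambda>n. cmod (1 / (2 * pi) * I (real n))) \<longlonglongrightarrow>
        cmod (complex_of_real (measure F {a<..b}) - complex_of_real (measure G {a<..b}))"
      unfolding I_def by (intro tendsto_norm) (simp add: right_diff_distrib)
    have bd: "cmod (1 / (2 * pi) * I (real n)) \<le> (\<integral>t. W t \<partial>lborel) / pi" for n
    proof -
      have "I (real n) = (CLBINT t=-real n..real n. K t * char F t - K t * char G t)"
        unfolding I_def
        by (rule interval_lebesgue_integral_diff(2)[symmetric]; rule int)
          (auto simp: F.cmod_char_le_1 G.cmod_char_le_1)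
      also have "\<dots> = (CLINT t|lborel. indicator {-real n<..<real n} t *\<^sub>R (K t * (char F t - char G t)))"
        by (simp add: interval_lebesgue_integral_def set_lebesgue_integral_def right_diff_distrib)
      also have "cmod \<dots> \<le> (\<integral>t. 2 * W t \<partial>lborel)"
      proof (rule order.trans[OF integral_norm_bound integral_mono_AE'])
        show "integrable lborel (\<lambda>t. 2 * W t)" using W by simp
        show "AE t in lborel. cmod (indicator {-real n<..<real n} t *\<^sub>R (K t * (char F t - char G t))) \<le> 2 * W t"
          using AE0
        proof eventually_elim
          case (elim t)
          have "cmod (K t * (char F t - char G t)) \<le> 2 / \<bar>t\<bar> * (\<bar>t\<bar> * W t)"
            unfolding norm_mult using K2 bound by (intro mult_mono) auto
          then show ?case using elim W_nonneg[of t] by (auto simp: indicator_def)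
        qed
        show "AE t in lborel. 0 \<le> 2 * W t"
          using AE0 by eventually_elim (simp add: W_nonneg)
      qed
      finally show ?thesis by (simp add: norm_mult norm_divide field_simps)
    qed
    have "cmod (complex_of_real (measure F {a<..b}) - complex_of_real (measure G {a<..b}))
        \<le> (\<integral>t. W t \<partial>lborel) / pi"
      by (rule LIMSEQ_le_const2[OF lim]) (use bd in blast)
    then show ?thesis by (simp flip: of_real_diff)
  qed
  \<comment> \<open>The interval bound requires endpoints without atoms. Atoms of F and G are
    countable, so such points exist both far to the left, where both distribution functions are
    nearly 0, and just to the right of x, where right continuity applies. Each choice costs half of
    the error.\<close>
  let ?D = "\<lambda>x. \<bar>cdf F x - cdf G x\<bar>"
  have count: "countable {x. measure F {x} \<noteq> 0 \<or> measure G {x} \<noteq> 0}"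
    using countable_Un[OF F.countable_support G.countable_support] by (simp add: Un_def)
  show ?thesis
  proof (rule field_le_epsilon)
    fix \<epsilon> :: real assume "\<epsilon> > 0"
    have "(?D \<longlongrightarrow> 0) at_bot"
      using F.cdf_lim_at_bot G.cdf_lim_at_bot by (intro tendsto_eq_intros) auto
    then have "eventually (\<lambda>y. ?D y < \<epsilon> / 2 \<and> y \<le> x) at_bot"
      using \<open>\<epsilon> > 0\<close> by (simp only: tendsto_iff dist_real_def diff_0_right eventually_conj eventually_le_at_bot abs_idempotent)
    then obtain c where "\<And>y. y \<le> c \<Longrightarrow> ?D y < \<epsilon> / 2" "c \<le> x"
      unfolding eventually_at_bot_linorder by auto
    with open_minus_countable[OF count, of "{..< c}"] obtain a where
      a: "measure F {a} = 0" "measure G {a} = 0" "a < c" "a \<le> x" and 1: "?D a < \<epsilon> / 2"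
      by auto
    have "(?D \<longlongrightarrow> ?D x) (at_right x)"
      using F.cdf_is_right_cont[of x] G.cdf_is_right_cont[of x]
      by (intro tendsto_intros) (auto simp add: continuous_within)
    then have "eventually (\<lambda>y. \<bar>?D y - ?D x\<bar> < \<epsilon> / 2) (at_right x)"
      using \<open>\<epsilon> > 0\<close> by (simp only: tendsto_iff dist_real_def eventually_conj eventually_at_right_less)
    then obtain N where "N > x" "\<And>y. x < y \<Longrightarrow> y < N \<Longrightarrow> \<bar>?D y - ?D x\<bar> < \<epsilon> / 2"
      by (auto simp add: eventually_at_right[OF less_add_one])
    with open_minus_countable[OF count, of "{x <..< N}"] obtain b where "x < b" "b < N"
        and b: "measure F {b} = 0" "measure G {b} = 0" and 2: "\<bar>?D b - ?D x\<bar> < \<epsilon> / 2"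
      by (auto simp: abs_minus_commute)
    have "a < b" using a \<open>x < b\<close> by simp
    then have "\<bar>(cdf F b - cdf F a) - (cdf G b - cdf G a)\<bar> \<le> (\<integral>t. W t \<partial>lborel) / pi"
      using Ioc[of a b] a b by (simp add: F.cdf_diff_eq G.cdf_diff_eq)
    then show "?D x \<le> (\<integral>t. W t \<partial>lborel) / pi + \<epsilon>" using 1 2 by linarith
  qed
qed

subsection \<open>Characteristic functions away from the origin\<close>

lemma pi_less_33: "pi < 33 / 10"
proof (rule ccontr)
  define y where "y = pi / 6"
  have sum3: "(\<Sum>m<3. sin_coeff m * y ^ m) = y"
    by (simp add: eval_nat_numeral sin_coeff_def)
  assume "\<not> ?thesis"
  \<comment> \<open>Since sin(pi/6) = 1/2, Taylor's bound gives y - 1/2 <= y^3/6 <= 2y/27, hence y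
    <= 27/50, which contradicts y >= 11/20.\<close>
  then have y: "11 / 20 \<le> y" "y \<le> 2 / 3" using pi_less_4 by (auto simp: y_def)
  have "\<bar>1 / 2 - y\<bar> \<le> y ^ 3 / 6"
    using Maclaurin_sin_bound[of y 3] y(1) unfolding sum3
    by (simp add: y_def sin_30 fact_numeral field_simps)
  moreover have "y ^ 2 \<le> (2 / 3) ^ 2" using y by (intro power_mono) auto
  then have "y * y ^ 2 \<le> y * (4 / 9)" using y by (intro mult_left_mono) (auto simp: power2_eq_square)
  then have "y ^ 3 \<le> y * (4 / 9)" by (simp add: power3_eq_cube power2_eq_square)
  ultimately show False using y by linarith
qed

text \<open>The value 3888/10000 is 12 * (9/50)^2, where 9/50 is the constant of the lower bound on
  the defect in \<open>cmod_char_le_away_from_zero\<close>.\<close>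

lemma pi_ratio_le: "pi\<^sup>2 / (2 + pi)\<^sup>2 \<le> 3888 / 10000"
proof -
  have "pi / (2 + pi) \<le> 623 / 1000"
  proof -
    have "pi \<le> 623 / 1000 * (2 + pi)" using pi_less_33 by simp
    then show ?thesis using pi_gt_zero by (simp add: pos_divide_le_eq add_pos_pos)
  qed
  then have "(pi / (2 + pi))\<^sup>2 \<le> (623 / 1000)\<^sup>2"
    using pi_gt_zero by (intro power_mono) auto
  also have "\<dots> \<le> 3888 / 10000" by (simp add: power2_eq_square)
  finally show ?thesis by (simp add: power_divide)
qed

section \<open>The defect 1 - |g|^2 and the decay of g away from 0\<close>

context real_distribution
begin

definition char_defect :: "real \<Rightarrow> real" where
  "char_defect t = 1 - (cmod (char M t))\<^sup>2"

lemma char_defect_nonneg: "0 \<le> char_defect t"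
  using power_mono[OF cmod_char_le_1[of t], of 2] by (simp add: char_defect_def)

lemma integrable_dist_iexp: "integrable M (\<lambda>x. (cmod (iexp (t * x) - c))\<^sup>2)"
proof (rule integrable_const_bound[of _ "(1 + cmod c)\<^sup>2"])
  show "AE x in M. norm ((cmod (iexp (t * x) - c))\<^sup>2) \<le> (1 + cmod c)\<^sup>2"
  proof (rule AE_I2)
    fix x
    have "cmod (iexp (t * x) - c) \<le> 1 + cmod c"
      using norm_triangle_ineq4[of "iexp (t * x)" c] by simp
    then show "norm ((cmod (iexp (t * x) - c))\<^sup>2) \<le> (1 + cmod c)\<^sup>2"
      by (simp add: power_mono)
  qed
qed simp

text \<open>This is the decomposition of a mean square distance into variance and squared bias, as
  |exp(itX)| = 1. Hence every constant c yields an upper bound for the defect; below, c is a product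
  of values of the characteristic function or 1.\<close>

lemma integral_dist_iexp:
  "(\<integral>x. (cmod (iexp (t * x) - c))\<^sup>2 \<partial>M) = char_defect t + (cmod (char M t - c))\<^sup>2"
proof -
  have exp: "(cmod (z - c))\<^sup>2 = (cmod z)\<^sup>2 - 2 * Re (cnj c * z) + (cmod c)\<^sup>2" for z
    by (simp add: cmod_power2) (simp add: power2_eq_square algebra_simps)
  define R where "R x = Re (cnj c * iexp (t * x))" for x
  have i: "integrable M R"
    unfolding R_def by (intro integrable_Re integrable_mult_right integrable_iexp) auto
  have "(\<integral>x. (cmod (iexp (t * x) - c))\<^sup>2 \<partial>M) = (\<integral>x. 1 - 2 * R x + (cmod c)\<^sup>2 \<partial>M)"
    unfolding exp R_def by (simp only: norm_exp_i_times one_power2)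
  also have "\<dots> = 1 - 2 * (\<integral>x. R x \<partial>M) + (cmod c)\<^sup>2"
    using i prob_space by simp
  also have "(\<integral>x. R x \<partial>M) = Re (cnj c * char M t)"
    unfolding char_def R_def
    by (subst integral_Re) (auto intro!: integrable_mult_right integrable_iexp)
  finally show ?thesis by (simp add: char_defect_def exp)
qed

(* A substitute for Minkowski's inequality in L^2: taking l = sqrt (V u) / sqrt (V t), up to an
   arbitrarily small correction, gives the subadditivity of sqrt V. *)
lemma char_defect_add_le:
  assumes l: "0 < l"
  shows "char_defect (t + u) \<le> (1 + l) * char_defect t + (1 + 1 / l) * char_defect u"
proof -
  let ?g = "char M"
  have sq: "(a + b)\<^sup>2 \<le> (1 + l) * a\<^sup>2 + (1 + 1 / l) * b\<^sup>2" for a b :: real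
  proof -
    have "0 \<le> (l * a - b)\<^sup>2 / l" using l by simp
    also have "\<dots> = (1 + l) * a\<^sup>2 + (1 + 1 / l) * b\<^sup>2 - (a + b)\<^sup>2"
      using l by (simp add: field_simps power2_eq_square)
    finally show ?thesis by simp
  qed
  \<comment> \<open>The product of the two means replaces the true mean of exp(i(t+u)X), which can
    only increase the mean square distance.\<close>
  have "char_defect (t + u) \<le> (\<integral>x. (cmod (iexp ((t + u) * x) - ?g t * ?g u))\<^sup>2 \<partial>M)"
    unfolding integral_dist_iexp by simp
  also have "\<dots> \<le> (\<integral>x. (1 + l) * (cmod (iexp (t * x) - ?g t))\<^sup>2 + (1 + 1 / l) * (cmod (iexp (u * x) - ?g u))\<^sup>2 \<partial>M)"
  proof (rule integral_mono)
    fix x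
    let ?a = "cmod (iexp (t * x) - ?g t)" and ?b = "cmod (iexp (u * x) - ?g u)"
    have "iexp ((t + u) * x) - ?g t * ?g u =
        iexp (u * x) * (iexp (t * x) - ?g t) + ?g t * (iexp (u * x) - ?g u)"
      by (simp add: algebra_simps exp_add)
    then have "cmod (iexp ((t + u) * x) - ?g t * ?g u) \<le>
        cmod (iexp (u * x) * (iexp (t * x) - ?g t)) + cmod (?g t * (iexp (u * x) - ?g u))"
      by (metis norm_triangle_ineq)
    also have "\<dots> \<le> ?a + ?b"
      using cmod_char_le_1[of t] by (simp add: norm_mult mult_left_le_one_le)
    finally have "(cmod (iexp ((t + u) * x) - ?g t * ?g u))\<^sup>2 \<le> (?a + ?b)\<^sup>2"
      by (intro power_mono) auto
    with sq[of ?a ?b] show "(cmod (iexp ((t + u) * x) - ?g t * ?g u))\<^sup>2 \<le> (1 + l) * ?a\<^sup>2 + (1 + 1 / l) * ?b\<^sup>2"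
      by linarith
  qed (intro Bochner_Integration.integrable_add integrable_mult_right integrable_dist_iexp)+
  also have "\<dots> = (1 + l) * char_defect t + (1 + 1 / l) * char_defect u"
    by (subst Bochner_Integration.integral_add)
      (auto intro!: integrable_mult_right integrable_dist_iexp simp: integral_dist_iexp simp del: of_real_mult)
  finally show ?thesis .
qed

lemma sqrt_char_defect_add_le:
  "sqrt (char_defect (t + u)) \<le> sqrt (char_defect t) + sqrt (char_defect u)"
proof (rule field_le_epsilon)
  fix e :: real assume "e > 0"
  \<comment> \<open>Adding e/2 keeps the quotient y/x meaningful when a defect is 0. With l = y/x
    the weighted sum collapses to (x + y)^2.\<close>
  define x where "x = sqrt (char_defect t) + e / 2"
  define y where "y = sqrt (char_defect u) + e / 2"
  have xy: "x > 0" "y > 0"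
    using \<open>e > 0\<close> char_defect_nonneg by (auto simp: x_def y_def intro!: add_nonneg_pos)
  have le: "char_defect t \<le> x\<^sup>2" "char_defect u \<le> y\<^sup>2"
    using \<open>e > 0\<close> char_defect_nonneg by (auto simp: x_def y_def intro!: sqrt_le_D)
  have "char_defect (t + u) \<le> (1 + y / x) * char_defect t + (1 + 1 / (y / x)) * char_defect u"
    using xy by (intro char_defect_add_le) simp
  also have "\<dots> \<le> (1 + y / x) * x\<^sup>2 + (1 + 1 / (y / x)) * y\<^sup>2"
    using xy le by (intro add_mono mult_left_mono) auto
  also have "\<dots> = (x + y)\<^sup>2"
    using xy by (simp add: field_simps power2_eq_square)
  finally have "sqrt (char_defect (t + u)) \<le> x + y"
    using xy by (intro real_le_lsqrt) (auto simp: char_defect_nonneg)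
  then show "sqrt (char_defect (t + u)) \<le> sqrt (char_defect t) + sqrt (char_defect u) + e"
    by (simp add: x_def y_def)
qed

lemma sqrt_char_defect_mult_le: "sqrt (char_defect (real k * t)) \<le> real k * sqrt (char_defect t)"
proof (induction k)
  case 0
  then show ?case by (simp add: char_defect_def char_zero)
next
  case (Suc k)
  then show ?case
    using sqrt_char_defect_add_le[of "real k * t" t] by (simp add: algebra_simps)
qed

text \<open>Taking c = 1 bounds the defect by the mean of |exp(iuX) - 1|^2, which is at most u^2
  times the second moment.\<close>

lemma sqrt_char_defect_le_abs:
  assumes "integrable M (\<lambda>x. x\<^sup>2)" "(\<integral>x. x\<^sup>2 \<partial>M) \<le> 1"
  shows "sqrt (char_defect u) \<le> \<bar>u\<bar>"
proof -
  have "char_defect u \<le> (\<integral>x. (cmod (iexp (u * x) - 1))\<^sup>2 \<partial>M)"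
    unfolding integral_dist_iexp by simp
  also have "\<dots> \<le> (\<integral>x. u\<^sup>2 * x\<^sup>2 \<partial>M)"
  proof (rule integral_mono)
    fix x
    have "cmod (iexp (u * x) - 1) \<le> \<bar>u * x\<bar>"
      using iexp_approx1[of "u * x" 0] by simp
    then have "(cmod (iexp (u * x) - 1))\<^sup>2 \<le> \<bar>u * x\<bar>\<^sup>2" by (intro power_mono) auto
    then show "(cmod (iexp (u * x) - 1))\<^sup>2 \<le> u\<^sup>2 * x\<^sup>2" by (simp add: power_mult_distrib)
  qed (use assms integrable_dist_iexp in auto)
  also have "\<dots> \<le> u\<^sup>2" using assms by (simp add: mult_left_le)
  finally show ?thesis by (intro real_le_lsqrt) (auto simp: char_defect_nonneg)
qed

lemma cmod_char_minus: "cmod (char M (- t)) = cmod (char M t)"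
proof -
  have "char M (- t) = (CLINT x|M. cnj (iexp (t * x)))"
    unfolding char_def by (intro Bochner_Integration.integral_cong) (auto simp: exp_cnj)
  also have "\<dots> = cnj (char M t)" unfolding char_def by simp
  finally have "char M (- t) = cnj (char M t)" .
  then show ?thesis by simp
qed

text \<open>Around each point ks with k <= N there is a unit interval on which |g| >= 3/5, and s >=
  1 makes these N + 1 intervals disjoint.\<close>

lemma integral_cmod_char_ge:
  assumes m2: "integrable M (\<lambda>x. x\<^sup>2)" "(\<integral>x. x\<^sup>2 \<partial>M) \<le> 1"
    and int: "integrable lborel (\<lambda>t. cmod (char M t))"
    and s: "1 \<le> s" and N: "real N * sqrt (char_defect s) \<le> 3 / 10"
  shows "3 / 5 * (real N + 1) \<le> (\<integral>t. cmod (char M t) \<partial>lborel)"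
proof -
  define I where "I k = {real k * s - 1 / 2 <..< real k * s + 1 / 2}" for k :: nat
  have disj: "disjoint_family_on I {..N}"
  proof -
    have "I i \<inter> I j = {}" if "i < j" for i j
    proof -
      have "real i + 1 \<le> real j" using that by simp
      then have "(real i + 1) * s \<le> real j * s" using s by (intro mult_right_mono) auto
      then show ?thesis using s by (auto simp: I_def algebra_simps)
    qed
    then show ?thesis by (metis (no_types, lifting) disjoint_family_on_def Int_commute linorder_neqE_nat)
  qed
  have U: "measure lborel (\<Union>k\<le>N. I k) = real N + 1"
    by (subst measure_finite_Union) (use disj in \<open>auto simp: I_def\<close>)
  have ge: "3 / 5 \<le> cmod (char M t)" if "t \<in> I k" "k \<le> N" for t k
  proof -
    define u where "u = t - real k * s"
    have "sqrt (char_defect (real k * s + u)) \<le> real k * sqrt (char_defect s) + \<bar>u\<bar>"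
      using sqrt_char_defect_add_le[of "real k * s" u] sqrt_char_defect_mult_le[of k s]
        sqrt_char_defect_le_abs[OF m2, of u] by linarith
    \<comment> \<open>The root of the defect is at most 3/10 + 1/2 = 8/10, so |g|^2 >= 1 - 64/100 =
      (3/5)^2.\<close>
    also have "\<dots> \<le> 3 / 10 + 1 / 2"
    proof (intro add_mono)
      show "real k * sqrt (char_defect s) \<le> 3 / 10"
        using N \<open>k \<le> N\<close> mult_right_mono[of "real k" "real N" "sqrt (char_defect s)"]
        by (simp add: char_defect_nonneg)
      show "\<bar>u\<bar> \<le> 1 / 2" using that(1) unfolding u_def I_def greaterThanLessThan_iff by linarith
    qed
    finally have "char_defect t \<le> (8 / 10)\<^sup>2"
      by (intro sqrt_le_D) (simp add: u_def)
    then have "(3 / 5)\<^sup>2 \<le> (cmod (char M t))\<^sup>2"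
      by (simp add: char_defect_def power2_eq_square)
    then show ?thesis by (rule power2_le_imp_le) simp
  qed
  have fin: "emeasure lborel (\<Union>k\<le>N. I k) < \<infinity>"
    by (rule le_less_trans[OF emeasure_subadditive_finite]) (auto simp: I_def of_nat_less_top)
  have "3 / 5 * (real N + 1) = (\<integral>t. 3 / 5 * indicator (\<Union>k\<le>N. I k) t \<partial>lborel)"
    using U by simp
  also have "\<dots> \<le> (\<integral>t. cmod (char M t) \<partial>lborel)"
  proof (rule integral_mono)
    show "integrable lborel (\<lambda>t. 3 / 5 * indicator (\<Union>k\<le>N. I k) t :: real)"
      using fin by (intro integrable_mult_right integrable_real_indicator) (auto simp: I_def)
    show "3 / 5 * indicator (\<Union>k\<le>N. I k) t \<le> cmod (char M t)" for t
      using ge by (auto simp: indicator_def)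
  qed (rule int)
  finally show ?thesis .
qed

text \<open>For N = 0 only the interval around the origin is counted, and it already contributes
  3/5.\<close>

lemma integral_cmod_char_pos:
  assumes "integrable M (\<lambda>x. x\<^sup>2)" "(\<integral>x. x\<^sup>2 \<partial>M) \<le> 1" "integrable lborel (\<lambda>t. cmod (char M t))"
  shows "0 < (\<integral>t. cmod (char M t) \<partial>lborel)"
  using integral_cmod_char_ge[OF assms, of 1 0] by simp

lemma cmod_char_le_away_from_zero:
  assumes m2: "integrable M (\<lambda>x. x\<^sup>2)" "(\<integral>x. x\<^sup>2 \<partial>M) \<le> 1"
    and int: "integrable lborel (\<lambda>t. cmod (char M t))"
    and s: "1 \<le> \<bar>s\<bar>"
  shows "cmod (char M s) \<le> exp (- (pi\<^sup>2 / (24 * (\<integral>t. cmod (char M t) \<partial>lborel)\<^sup>2 * (2 + pi)\<^sup>2)))"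
proof -
  define B where "B = (\<integral>t. cmod (char M t) \<partial>lborel)"
  have B: "B > 0" unfolding B_def by (rule integral_cmod_char_pos[OF m2 int])
  define r where "r = sqrt (char_defect \<bar>s\<bar>)"
  \<comment> \<open>The constant is 9/50 = (3/10) / (5/3). With N the integer part of 5B/3, a
    smaller r would give N r <= 3/10, and the intervals would force 3(N + 1)/5 <= B although N + 1 >
    5B/3.\<close>
  have r: "9 / (50 * B) \<le> r"
  proof (rule ccontr)
    assume "\<not> ?thesis"
    then have "r < 9 / (50 * B)" by simp
    define N where "N = nat \<lfloor>5 * B / 3\<rfloor>"
    have N: "real N \<le> 5 * B / 3" "5 * B / 3 < real N + 1"
      using B of_nat_floor[of "5 * B / 3"] by (auto simp: N_def)
    have "real N * r \<le> 5 * B / 3 * (9 / (50 * B))"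
      using N(1) B \<open>r < 9 / (50 * B)\<close> by (intro mult_mono) (auto simp: r_def char_defect_nonneg)
    also have "\<dots> = 3 / 10" using B by simp
    finally have "3 / 5 * (real N + 1) \<le> B"
      unfolding B_def r_def using m2 int s by (intro integral_cmod_char_ge[of "\<bar>s\<bar>"]) auto
    with N(2) show False by simp
  qed
  have "(9 / (50 * B))\<^sup>2 \<le> r\<^sup>2" using r B by (intro power_mono) auto
  also have "r\<^sup>2 = 1 - (cmod (char M s))\<^sup>2"
  proof -
    have "cmod (char M \<bar>s\<bar>) = cmod (char M s)" by (cases "0 \<le> s") (auto simp: cmod_char_minus)
    then show ?thesis by (simp add: r_def char_defect_nonneg) (simp add: char_defect_def)
  qed
  finally have "(cmod (char M s))\<^sup>2 \<le> 1 - (9 / (50 * B))\<^sup>2" by simp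
  also have "\<dots> \<le> exp (- ((9 / (50 * B))\<^sup>2))"
    using exp_ge_add_one_self[of "- ((9 / (50 * B))\<^sup>2)"] by simp
  \<comment> \<open>The bound concerns |g|^2, so taking the square root halves the exponent; this is
    how 12 becomes 24.\<close>
  also have "\<dots> \<le> exp (- (pi\<^sup>2 / (24 * B\<^sup>2 * (2 + pi)\<^sup>2))) ^ 2"
  proof -
    have "2 * (pi\<^sup>2 / (24 * B\<^sup>2 * (2 + pi)\<^sup>2)) = pi\<^sup>2 / (2 + pi)\<^sup>2 * (1 / (12 * B\<^sup>2))"
      using B by (simp add: field_simps)
    also have "\<dots> \<le> 3888 / 10000 * (1 / (12 * B\<^sup>2))"
      by (intro mult_right_mono pi_ratio_le) auto
    also have "\<dots> = (9 / (50 * B))\<^sup>2"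
      using B by (simp add: field_simps power2_eq_square)
    finally show ?thesis by (simp flip: exp_of_nat_mult)
  qed
  finally show ?thesis
    unfolding B_def by (rule power2_le_imp_le) simp
qed

end

subsection \<open>Gaussian integrals and estimates near the origin\<close>

text \<open>It brings the Gamma value into the factorial form in which
  \<open>gaussian_moment_even_pos\<close> gives the even moments.\<close>

lemma Gamma_nat_plus_half: "Gamma (real k + 1 / 2) = sqrt pi * (fact (2 * k) / (2 ^ (2 * k) * fact k))"
proof (induction k)
  case 0
  then show ?case by (simp add: Gamma_one_half_real)
next
  case (Suc k)
  have "Gamma (real (Suc k) + 1 / 2) = Gamma ((real k + 1 / 2) + 1)" by (simp add: algebra_simps)
  also have "\<dots> = (real k + 1 / 2) * Gamma (real k + 1 / 2)"
    by (rule Gamma_plus1) (auto simp: nonpos_Ints_def)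
  also have "\<dots> = sqrt pi * (fact (2 * Suc k) / (2 ^ (2 * Suc k) * fact (Suc k)))"
  proof -
    have f: "fact (2 * Suc k) = 2 * (real k + 1) * ((2 * real k + 1) * fact (2 * k))"
      by (simp add: algebra_simps)
    have g: "fact (Suc k) = (real k + 1) * fact k" by (simp add: algebra_simps)
    have p: "2 ^ (2 * Suc k) = (4::real) * 2 ^ (2 * k)" by simp
    show ?thesis unfolding Suc.IH f g p
      by (simp add: divide_simps del: fact_Suc) (simp add: algebra_simps)
  qed
  finally show ?case .
qed

lemma has_bochner_integral_abs_power_gauss:
  "has_bochner_integral lborel (\<lambda>x::real. exp (- x\<^sup>2) * \<bar>x\<bar> ^ k) (Gamma ((real k + 1) / 2))"
proof -
  have *: "has_bochner_integral lborel (\<lambda>x::real. indicator {0..} x *\<^sub>R (exp (- x\<^sup>2) * \<bar>x\<bar> ^ k)) (Gamma ((real k + 1) / 2) / 2)"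
  proof (cases "even k")
    case True
    then obtain j where j: "k = 2 * j" by blast
    have "(real k + 1) / 2 = real j + 1 / 2" by (simp add: j add_divide_distrib)
    then have "Gamma ((real k + 1) / 2) = sqrt pi * (fact (2 * j) / (2 ^ (2 * j) * fact j))"
      by (simp only: Gamma_nat_plus_half)
    then have v: "Gamma ((real k + 1) / 2) / 2 = (sqrt pi / 2) * (fact (2 * j) / (2 ^ (2 * j) * fact j))"
      by simp
    show ?thesis unfolding v
      using gaussian_moment_even_pos[of j]
      by (rule has_bochner_integral_cong[THEN iffD1, rotated -1]) (auto simp: j indicator_def)
  next
    case False
    then obtain j where j: "k = 2 * j + 1" by (elim oddE)
    have "(real k + 1) / 2 = 1 + real j" by (simp add: j)
    then have v: "Gamma ((real k + 1) / 2) / 2 = fact j / 2" by (simp only: Gamma_fact)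
    show ?thesis unfolding v
      using gaussian_moment_odd_pos[of j]
      by (rule has_bochner_integral_cong[THEN iffD1, rotated -1]) (auto simp: j indicator_def)
  qed
  from has_bochner_integral_even_function[OF *] show ?thesis by simp
qed

lemma has_bochner_integral_abs_power_gauss_scaled:
  assumes c: "0 < c"
  shows "has_bochner_integral lborel (\<lambda>x::real. \<bar>x\<bar> ^ k * exp (- x\<^sup>2 / c))
    (c powr ((real k + 1) / 2) * Gamma ((real k + 1) / 2))"
proof -
  have "has_bochner_integral lborel (\<lambda>x. exp (- (0 + 1 / sqrt c * x)\<^sup>2) * \<bar>0 + 1 / sqrt c * x\<bar> ^ k)
      (Gamma ((real k + 1) / 2) /\<^sub>R \<bar>1 / sqrt c\<bar>)"
    using c has_bochner_integral_abs_power_gauss[of k]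
    by (subst lborel_has_bochner_integral_real_affine_iff[symmetric]) auto
  then have "has_bochner_integral lborel (\<lambda>x. sqrt c ^ k * (exp (- (0 + 1 / sqrt c * x)\<^sup>2) * \<bar>0 + 1 / sqrt c * x\<bar> ^ k))
      (sqrt c ^ k * (Gamma ((real k + 1) / 2) /\<^sub>R \<bar>1 / sqrt c\<bar>))"
    by (rule has_bochner_integral_mult_right)
  also have "(\<lambda>x. sqrt c ^ k * (exp (- (0 + 1 / sqrt c * x)\<^sup>2) * \<bar>0 + 1 / sqrt c * x\<bar> ^ k)) =
      (\<lambda>x. \<bar>x\<bar> ^ k * exp (- x\<^sup>2 / c))"
    using c by (auto simp: power_divide abs_divide)
  also have "sqrt c ^ k * (Gamma ((real k + 1) / 2) /\<^sub>R \<bar>1 / sqrt c\<bar>) = sqrt c ^ (k + 1) * Gamma ((real k + 1) / 2)"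
    using c by (simp add: field_simps)
  also have "sqrt c ^ (k + 1) = c powr ((real k + 1) / 2)"
  proof -
    have "sqrt c ^ (k + 1) = sqrt c powr real (k + 1)"
      using c by (simp only: powr_realpow real_sqrt_gt_0_iff)
    also have "\<dots> = c powr (1 / 2 * real (k + 1))"
      using c by (simp only: powr_half_sqrt[symmetric] powr_powr less_imp_le)
    finally show ?thesis by (simp add: add.commute)
  qed
  finally show ?thesis .
qed

text \<open>The factor |x| gives the integrand the explicit antiderivative -exp(-x^2/2) on the
  positive half-line, and the indicator of |x| keeps it even.\<close>

lemma has_bochner_integral_gauss_tail:
  assumes a: "0 \<le> a"
  shows "has_bochner_integral lborel (\<lambda>x::real. indicator {a..} \<bar>x\<bar> * (\<bar>x\<bar> * exp (- x\<^sup>2 / 2))) (2 * exp (- a\<^sup>2 / 2))"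
proof -
  have lim: "((\<lambda>x::real. - exp (- x\<^sup>2 / 2)) \<longlongrightarrow> 0) at_top"
  proof -
    have "LIM x at_top. (1 / 2) * x\<^sup>2 :> (at_top :: real filter)"
      by (intro filterlim_tendsto_pos_mult_at_top[OF tendsto_const] filterlim_pow_at_top filterlim_ident) auto
    then have "LIM x at_top. - x\<^sup>2 / 2 :> (at_bot :: real filter)"
      by (simp add: filterlim_uminus_at_bot)
    from tendsto_minus[OF filterlim_compose[OF exp_at_bot this]] show ?thesis by simp
  qed
  have "(\<integral>\<^sup>+x. ennreal (x * exp (- x\<^sup>2 / 2)) * indicator {a..} x \<partial>lborel) = ennreal (0 - - exp (- a\<^sup>2 / 2))"
    using a by (intro nn_integral_FTC_atLeast lim) (auto intro!: derivative_eq_intros)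
  moreover have "ennreal (x * exp (- x\<^sup>2 / 2)) * indicator {a..} x =
      ennreal (indicator {0..} x *\<^sub>R (indicator {a..} \<bar>x\<bar> * (\<bar>x\<bar> * exp (- x\<^sup>2 / 2))))" for x
    using a by (auto simp: indicator_def)
  ultimately have "has_bochner_integral lborel
      (\<lambda>x::real. indicator {0..} x *\<^sub>R (indicator {a..} \<bar>x\<bar> * (\<bar>x\<bar> * exp (- x\<^sup>2 / 2)))) (exp (- a\<^sup>2 / 2))"
    by (intro has_bochner_integral_nn_integral) auto
  from has_bochner_integral_even_function[OF this] show ?thesis by simp
qed

section \<open>Gaussian domination near the origin\<close>

lemma power_div_fact_le_exp:
  fixes x :: real
  assumes x: "0 \<le> x"
  shows "x ^ (p + 2) / fact (p + 2) \<le> x\<^sup>2 * exp x / ((real p + 1) * (real p + 2))"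
proof -
  \<comment> \<open>The term of index p of the exponential series is at most exp x; multiplying it
    by x^2/((p+1)(p+2)) produces the term of index p + 2.\<close>
  have "(\<Sum>n<Suc p. x ^ n /\<^sub>R fact n) \<le> exp x"
    unfolding exp_def using x by (intro sum_le_suminf summable_exp_generic) auto
  moreover have "x ^ p / fact p \<le> (\<Sum>n<Suc p. x ^ n /\<^sub>R fact n)"
    using x by (simp add: divide_inverse mult.commute sum_nonneg)
  ultimately have "x ^ p / fact p * (x\<^sup>2 / ((real p + 1) * (real p + 2))) \<le> exp x * (x\<^sup>2 / ((real p + 1) * (real p + 2)))"
    by (intro mult_right_mono) auto
  moreover have "x ^ (p + 2) / fact (p + 2) = x ^ p / fact p * (x\<^sup>2 / ((real p + 1) * (real p + 2)))"
    by (simp add: power_add field_simps power2_eq_square)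
  ultimately show ?thesis by (simp add: mult.commute)
qed

text \<open>The condition on v is shaped so that exp(-1/2 - x^2) times the growth exp(x^2/2 + 1/2)
  of the Taylor bound leaves exp(-x^2/2). The error then fits into the gap exp(-s^2/6) -
  exp(-s^2/2). For T = 1 the condition reads v <= exp(-3/2)/2.\<close>

lemma norm_le_exp_of_near_gauss:
  fixes z :: complex and s T v :: real
  assumes v: "0 \<le> v" "v \<le> exp (- (1 / 2) - T\<^sup>2) / 2" and s: "\<bar>s\<bar> \<le> T" and m: "3 \<le> m"
    and z: "cmod (z - of_real (exp (- s\<^sup>2 / 2))) \<le> v * (\<bar>s\<bar> ^ (m + 1) / fact (m + 1) + 2 * \<bar>s\<bar> ^ m / fact m)"
  shows "cmod z \<le> exp (- s\<^sup>2 / 6)"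
proof -
  define x where "x = \<bar>s\<bar>"
  have x: "0 \<le> x" "x \<le> T" "s\<^sup>2 = x\<^sup>2" using s by (auto simp: x_def)
  have prod: "a * b \<le> (real p + 1) * (real p + 2)" if "a \<le> real p + 1" "b \<le> real p + 2" "0 \<le> a" "0 \<le> b" for a b p
    using that by (intro mult_mono) auto
  have e: "m - 2 + 2 = m" "m - 1 + 2 = m + 1" using m by auto
  have f1: "x ^ m / fact m \<le> x\<^sup>2 * exp x / 6"
  proof -
    have "x ^ m / fact m \<le> x\<^sup>2 * exp x / ((real (m - 2) + 1) * (real (m - 2) + 2))"
      using power_div_fact_le_exp[OF x(1), of "m - 2"] unfolding e .
    also have "\<dots> \<le> x\<^sup>2 * exp x / 6"
      using prod[of 2 "m - 2" 3] m by (intro divide_left_mono) auto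
    finally show ?thesis .
  qed
  have f2: "x ^ (m + 1) / fact (m + 1) \<le> x\<^sup>2 * exp x / 12"
  proof -
    have "x ^ (m + 1) / fact (m + 1) \<le> x\<^sup>2 * exp x / ((real (m - 1) + 1) * (real (m - 1) + 2))"
      using power_div_fact_le_exp[OF x(1), of "m - 1"] unfolding e .
    also have "\<dots> \<le> x\<^sup>2 * exp x / 12"
      using prod[of 3 "m - 1" 4] m by (intro divide_left_mono) auto
    finally show ?thesis .
  qed
  \<comment> \<open>Since m >= 3, the denominators are at least 2 * 3 = 6 and 3 * 4 = 12, and 1/12 +
    2/6 = 5/12. The exponential is then made Gaussian by 2x <= x^2 + 1.\<close>
  have "x ^ (m + 1) / fact (m + 1) + 2 * x ^ m / fact m \<le> 5 / 12 * (x\<^sup>2 * exp x)"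
    using f1 f2 by (simp del: fact_Suc)
  also have "\<dots> \<le> 5 / 12 * (x\<^sup>2 * exp (x\<^sup>2 / 2 + 1 / 2))"
    using sum_squares_bound[of x 1] by (intro mult_left_mono) auto
  finally have poly: "x ^ (m + 1) / fact (m + 1) + 2 * x ^ m / fact m \<le> 5 / 12 * (x\<^sup>2 * exp (x\<^sup>2 / 2 + 1 / 2))" .
  have "v * (x ^ (m + 1) / fact (m + 1) + 2 * x ^ m / fact m) \<le>
      (exp (- (1 / 2) - x\<^sup>2) / 2) * (5 / 12 * (x\<^sup>2 * exp (x\<^sup>2 / 2 + 1 / 2)))"
  proof (intro mult_mono)
    have "x\<^sup>2 \<le> T\<^sup>2" using x by (intro power_mono) auto
    then have "exp (- (1 / 2) - T\<^sup>2) \<le> exp (- (1 / 2) - x\<^sup>2)" by simp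
    then show "v \<le> exp (- (1 / 2) - x\<^sup>2) / 2" using v by linarith
  next
    show "x ^ (m + 1) / fact (m + 1) + 2 * x ^ m / fact m \<le> 5 / 12 * (x\<^sup>2 * exp (x\<^sup>2 / 2 + 1 / 2))"
      by (rule poly)
    show "0 \<le> x ^ (m + 1) / fact (m + 1) + 2 * x ^ m / fact m"
      using x(1) by (intro add_nonneg_nonneg divide_nonneg_nonneg mult_nonneg_nonneg) auto
  qed simp
  also have "\<dots> = 5 / 24 * x\<^sup>2 * (exp (- (1 / 2) - x\<^sup>2) * exp (x\<^sup>2 / 2 + 1 / 2))"
    by simp
  also have "\<dots> = 5 / 24 * x\<^sup>2 * exp (- x\<^sup>2 / 2)"
    by (simp flip: exp_add)
  also have "\<dots> \<le> exp (- x\<^sup>2 / 2) * (exp (x\<^sup>2 / 3) - 1)"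
  proof -
    have "5 / 24 * x\<^sup>2 \<le> exp (x\<^sup>2 / 3) - 1"
      using exp_ge_add_one_self[of "x\<^sup>2 / 3"] zero_le_power2[of x] by linarith
    then show ?thesis by (simp add: mult.commute mult_left_mono)
  qed
  also have "\<dots> = exp (- x\<^sup>2 / 6) - exp (- x\<^sup>2 / 2)"
    by (simp add: right_diff_distrib flip: exp_add)
  finally have "v * (x ^ (m + 1) / fact (m + 1) + 2 * x ^ m / fact m) \<le> exp (- s\<^sup>2 / 6) - exp (- s\<^sup>2 / 2)"
    unfolding x(3) .
  from order.trans[OF z[folded x_def] this]
  have "cmod (z - of_real (exp (- s\<^sup>2 / 2))) \<le> exp (- s\<^sup>2 / 6) - exp (- s\<^sup>2 / 2)" .
  moreover have "cmod z \<le> cmod (z - of_real (exp (- s\<^sup>2 / 2))) + cmod (of_real (exp (- s\<^sup>2 / 2)))"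
    using norm_triangle_ineq[of "z - of_real (exp (- s\<^sup>2 / 2))" "of_real (exp (- s\<^sup>2 / 2))"] by simp
  ultimately show ?thesis by (simp add: norm_of_real)
qed

text \<open>Dividing by r moves both numbers into the closed unit disc, where
  \<open>norm_power_diff\<close> applies.\<close>

lemma norm_power_diff_le:
  fixes z w :: complex
  assumes "norm z \<le> r" "norm w \<le> r" "0 < r"
  shows "norm (z ^ n - w ^ n) \<le> real n * r ^ (n - 1) * norm (z - w)"
proof (cases n)
  case (Suc k)
  have "norm ((z / of_real r) ^ n - (w / of_real r) ^ n) \<le> real n * norm (z / of_real r - w / of_real r)"
    using assms by (intro norm_power_diff) (auto simp: norm_divide)
  then have "norm (z ^ n - w ^ n) / r ^ n \<le> real n * (norm (z - w) / r)"
    using assms(3) by (simp add: power_divide norm_divide norm_power flip: diff_divide_distrib)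
  then show ?thesis using assms(3) Suc by (simp add: field_simps)
qed simp

subsection \<open>The bound on the distance of the distribution functions\<close>

lemma sqrt_power_quotient:
  assumes "0 < n"
  shows "real n / sqrt (real n) ^ k = 1 / real n powr ((real k - 2) / 2)"
proof -
  have "sqrt (real n) ^ k = sqrt (real n) powr real k"
    using assms by (simp only: powr_realpow real_sqrt_gt_0_iff of_nat_0_less_iff)
  also have "\<dots> = real n powr (1 / 2 * real k)"
    by (simp only: powr_half_sqrt[symmetric] powr_powr of_nat_0_le_iff)
  also have "1 / 2 * real k = (real k - 2) / 2 + 1" by (simp add: field_simps)
  also have "real n powr \<dots> = real n powr ((real k - 2) / 2) * real n"
    using assms by (simp add: powr_add)
  finally show ?thesis using assms by simp
qed

text \<open>The cut-off T remains a parameter: the Taylor region |t| < T sqrt n needs v1 and v2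
  small in terms of T, while the Gaussian tail shrinks as T grows. With T >= 1, all of the outer
  region lies where |g| <= b.\<close>

lemma cdf_diff_le_of_char_power:
  fixes P F :: "real measure" and v1 v2 T B b :: real and m n :: nat
  assumes P: "real_distribution P" and F: "real_distribution F"
    and m2: "integrable P (\<lambda>x. x\<^sup>2)" "(\<integral>x. x\<^sup>2 \<partial>P) \<le> 1"
    and int: "integrable lborel (\<lambda>t. cmod (char P t))"
    and B: "B = (\<integral>t. cmod (char P t) \<partial>lborel)"
    and b: "b = exp (- (pi\<^sup>2 / (24 * B\<^sup>2 * (2 + pi)\<^sup>2)))"
    and charF: "\<And>t. char F t = char P (t / sqrt (real n)) ^ n"
    and diff: "\<And>t. cmod (char P t - char std_normal_distribution t) \<le>
      \<bar>t\<bar> ^ (m + 1) / fact (m + 1) * v1 + 2 * \<bar>t\<bar> ^ m / fact m * v2"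
    and v: "0 \<le> v1" "0 \<le> v2" "max v1 v2 \<le> exp (- (1 / 2) - T\<^sup>2) / 2"
    and T: "1 \<le> T" and n: "2 \<le> n" and m: "3 \<le> m"
  shows "\<bar>cdf F x - cdf std_normal_distribution x\<bar> \<le>
    C1 m * v1 / real n powr ((real m - 1) / 2) + C2 m * v2 / real n powr ((real m - 2) / 2)
    + B / pi * b ^ (n - 1) + 2 * exp (- (T\<^sup>2 * real n / 2)) / (pi * (T\<^sup>2 * real n))"
proof -
  interpret P: real_distribution P by (rule P)
  define q where "q = sqrt (real n)"
  have q: "0 < q" "q\<^sup>2 = real n" "1 \<le> q" using n by (auto simp: q_def)
  define g where "g = char P"
  \<comment> \<open>\<open>W1\<close> and \<open>W2\<close> control the inner region;
    \<open>W3\<close> and \<open>W4\<close> control the characteristic function of F and the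
    Gaussian one in the outer region. All four are nonnegative and integrable, so their sum is a
    single majorant on the whole line.\<close>
  define W1 where "W1 t = v1 / fact (m + 1) * (real n / q ^ (m + 1)) * (\<bar>t\<bar> ^ m * exp (- t\<^sup>2 / 12))" for t :: real
  define W2 where "W2 t = 2 * v2 / fact m * (real n / q ^ m) * (\<bar>t\<bar> ^ (m - 1) * exp (- t\<^sup>2 / 12))" for t :: real
  define W3 where "W3 t = b ^ (n - 1) / q * cmod (g (t / q))" for t :: real
  define W4 where "W4 t = 1 / (T\<^sup>2 * real n) * (indicator {T * q..} \<bar>t\<bar> * (\<bar>t\<bar> * exp (- t\<^sup>2 / 2)))" for t :: real
  define W where "W t = W1 t + W2 t + W3 t + W4 t" for t
  have b0: "0 < b" by (simp add: b)
  have W_nonneg: "0 \<le> W1 t" "0 \<le> W2 t" "0 \<le> W3 t" "0 \<le> W4 t" for t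
    using v q b0 by (auto simp: W1_def W2_def W3_def W4_def)

  have "has_bochner_integral lborel W1
      (v1 / fact (m + 1) * (real n / q ^ (m + 1)) * (12 powr ((real m + 1) / 2) * Gamma ((real m + 1) / 2)))"
    unfolding W1_def by (intro has_bochner_integral_mult_right has_bochner_integral_abs_power_gauss_scaled) auto
  moreover have "has_bochner_integral lborel W2
      (2 * v2 / fact m * (real n / q ^ m) * (12 powr ((real (m - 1) + 1) / 2) * Gamma ((real (m - 1) + 1) / 2)))"
    unfolding W2_def by (intro has_bochner_integral_mult_right has_bochner_integral_abs_power_gauss_scaled) auto
  moreover have "has_bochner_integral lborel W3 (b ^ (n - 1) / q * (q * B))"
  proof -
    have "has_bochner_integral lborel (\<lambda>t. cmod (g t)) B"
      using int by (simp add: has_bochner_integral_iff B g_def)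
    then have "has_bochner_integral lborel (\<lambda>t. cmod (g (0 + 1 / q * t))) (B /\<^sub>R \<bar>1 / q\<bar>)"
      using q by (subst lborel_has_bochner_integral_real_affine_iff[symmetric]) auto
    then have "has_bochner_integral lborel (\<lambda>t. cmod (g (t / q))) (q * B)"
      using q by simp
    then show ?thesis unfolding W3_def by (rule has_bochner_integral_mult_right)
  qed
  moreover have "has_bochner_integral lborel W4 (1 / (T\<^sup>2 * real n) * (2 * exp (- (T * q)\<^sup>2 / 2)))"
    unfolding W4_def using T q by (intro has_bochner_integral_mult_right has_bochner_integral_gauss_tail) auto
  ultimately have W_int: "has_bochner_integral lborel W
      (v1 / fact (m + 1) * (real n / q ^ (m + 1)) * (12 powr ((real m + 1) / 2) * Gamma ((real m + 1) / 2)) +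
       2 * v2 / fact m * (real n / q ^ m) * (12 powr ((real (m - 1) + 1) / 2) * Gamma ((real (m - 1) + 1) / 2)) +
       b ^ (n - 1) / q * (q * B) + 1 / (T\<^sup>2 * real n) * (2 * exp (- (T * q)\<^sup>2 / 2)))"
    unfolding W_def by (intro has_bochner_integral_add)

  have char_normal: "char std_normal_distribution t = of_real (exp (- t\<^sup>2 / 2))" for t
    by (simp add: char_std_normal_distribution)
  have char_normal_power: "char std_normal_distribution t = char std_normal_distribution (t / q) ^ n" for t
  proof -
    have "exp (- (t / q)\<^sup>2 / 2) ^ n = exp (- t\<^sup>2 / 2)"
      using n by (simp add: power_divide q flip: exp_of_nat_mult)
    then show ?thesis by (simp only: char_normal flip: of_real_power)
  qed
  have bound: "cmod (char F t - char std_normal_distribution t) \<le> \<bar>t\<bar> * W t" for t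
  proof (cases "\<bar>t\<bar> < T * q")
    case True
    define s where "s = t / q"
    have s: "\<bar>s\<bar> \<le> T" using True q by (simp add: s_def abs_divide field_simps)
    have st: "t\<^sup>2 = real n * s\<^sup>2" using q n by (simp add: s_def power_divide)
    have mono: "\<bar>s\<bar> ^ (m + 1) / fact (m + 1) * v1 + 2 * \<bar>s\<bar> ^ m / fact m * v2 \<le>
        max v1 v2 * (\<bar>s\<bar> ^ (m + 1) / fact (m + 1) + 2 * \<bar>s\<bar> ^ m / fact m)"
    proof -
      have "\<bar>s\<bar> ^ (m + 1) / fact (m + 1) * v1 \<le> \<bar>s\<bar> ^ (m + 1) / fact (m + 1) * max v1 v2"
        "2 * \<bar>s\<bar> ^ m / fact m * v2 \<le> 2 * \<bar>s\<bar> ^ m / fact m * max v1 v2"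
        by (intro mult_left_mono; simp)+
      then show ?thesis by (simp only: distrib_left mult.commute[of "max v1 v2"])
    qed
    have gs: "cmod (g s) \<le> exp (- s\<^sup>2 / 6)"
      using v order.trans[OF diff mono] s m
      by (intro norm_le_exp_of_near_gauss[where v="max v1 v2" and T=T and m=m]) (auto simp: g_def char_normal le_max_iff_disj)
    have ns: "cmod (char std_normal_distribution s) \<le> exp (- s\<^sup>2 / 6)"
      by (simp add: char_normal)
    have "char F t - char std_normal_distribution t = g s ^ n - char std_normal_distribution s ^ n"
      by (simp add: charF char_normal_power[of t] g_def s_def q_def)
    then have "cmod (char F t - char std_normal_distribution t) \<le>
        real n * exp (- s\<^sup>2 / 6) ^ (n - 1) * cmod (g s - char std_normal_distribution s)"
      using norm_power_diff_le[OF gs ns] by simp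
    also have "\<dots> \<le> real n * exp (- t\<^sup>2 / 12) *
        (\<bar>s\<bar> ^ (m + 1) / fact (m + 1) * v1 + 2 * \<bar>s\<bar> ^ m / fact m * v2)"
    proof (intro mult_mono mult_left_mono)
      \<comment> \<open>As n >= 2, n - 1 >= n/2; this turns (n - 1) s^2/6 into at least n s^2/12 =
        t^2/12 and is the source of the powers of 12.\<close>
      have "real n * s\<^sup>2 \<le> 2 * real (n - 1) * s\<^sup>2"
        using n by (intro mult_right_mono) auto
      then have "real (n - 1) * (- s\<^sup>2 / 6) \<le> - t\<^sup>2 / 12" unfolding st by simp
      then show "exp (- s\<^sup>2 / 6) ^ (n - 1) \<le> exp (- t\<^sup>2 / 12)"
        by (simp only: exp_le_cancel_iff flip: exp_of_nat_mult)
      show "cmod (g s - char std_normal_distribution s) \<le>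
          \<bar>s\<bar> ^ (m + 1) / fact (m + 1) * v1 + 2 * \<bar>s\<bar> ^ m / fact m * v2"
        unfolding g_def by (rule diff)
    qed auto
    also have "\<dots> = \<bar>t\<bar> * (W1 t + W2 t)"
    proof -
      have "\<bar>s\<bar> ^ (m + 1) = \<bar>t\<bar> * \<bar>t\<bar> ^ m / q ^ (m + 1)" "\<bar>s\<bar> ^ m = \<bar>t\<bar> * \<bar>t\<bar> ^ (m - 1) / q ^ m"
        using q m by (auto simp: s_def abs_divide power_divide simp flip: power_Suc)
      then show ?thesis unfolding W1_def W2_def
        by (simp add: algebra_simps del: fact_Suc power_Suc)
    qed
    also have "\<dots> \<le> \<bar>t\<bar> * W t"
      using W_nonneg[of t] unfolding W_def by (intro mult_left_mono) auto
    finally show ?thesis .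
  next
    case False
    have q_le: "q \<le> T * q" using T q by simp
    then have t: "q \<le> \<bar>t\<bar>" "T * q \<le> \<bar>t\<bar>" "0 < \<bar>t\<bar>" using False q by linarith+
    have "cmod (g (t / q)) \<le> b"
      unfolding g_def b B using t q by (intro P.cmod_char_le_away_from_zero[OF m2 int]) (simp add: abs_divide)
    \<comment> \<open>Only n - 1 of the n factors are bounded by b; the last one is kept for
      integrability.\<close>
    then have "cmod (char F t) \<le> b ^ (n - 1) * cmod (g (t / q))"
    proof -
      assume le: "cmod (g (t / q)) \<le> b"
      have "cmod (char F t) = cmod (g (t / q)) ^ (n - 1) * cmod (g (t / q))"
        using n by (simp add: charF g_def q_def norm_power flip: power_Suc2)
      also have "\<dots> \<le> b ^ (n - 1) * cmod (g (t / q))"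
        using le by (intro mult_right_mono power_mono) auto
      finally show ?thesis .
    qed
    also have "\<dots> \<le> \<bar>t\<bar> / q * (b ^ (n - 1) * cmod (g (t / q)))"
      using t q b0 mult_right_mono[of 1 "\<bar>t\<bar> / q" "b ^ (n - 1) * cmod (g (t / q))"] by simp
    also have "\<dots> = \<bar>t\<bar> * W3 t" by (simp add: W3_def)
    finally have 1: "cmod (char F t) \<le> \<bar>t\<bar> * W3 t" .
    have "cmod (char std_normal_distribution t) = exp (- t\<^sup>2 / 2)"
      by (simp add: char_normal)
    \<comment> \<open>Inserting the factor t^2/(T^2 n) >= 1 leaves |t| exp(-t^2/2) after division by
      |t|, which integrates in closed form.\<close>
    also have "\<dots> \<le> t\<^sup>2 / (T\<^sup>2 * real n) * exp (- t\<^sup>2 / 2)"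
    proof -
      have "(T * q)\<^sup>2 \<le> \<bar>t\<bar>\<^sup>2" using t T q by (intro power_mono) auto
      then have "1 \<le> t\<^sup>2 / (T\<^sup>2 * real n)" using T q n by (simp add: power_mult_distrib)
      then show ?thesis using mult_right_mono[of 1 "t\<^sup>2 / (T\<^sup>2 * real n)" "exp (- t\<^sup>2 / 2)"] by simp
    qed
    also have "\<dots> = \<bar>t\<bar> * W4 t"
      using t by (simp add: W4_def power2_eq_square)
    finally have 2: "cmod (char std_normal_distribution t) \<le> \<bar>t\<bar> * W4 t" .
    have "cmod (char F t - char std_normal_distribution t) \<le> \<bar>t\<bar> * (W3 t + W4 t)"
      using norm_triangle_ineq4[of "char F t" "char std_normal_distribution t"] 1 2
      by (simp add: distrib_left)
    also have "\<dots> \<le> \<bar>t\<bar> * W t"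
      using W_nonneg[of t] unfolding W_def by (intro mult_left_mono) auto
    finally show ?thesis .
  qed
  have "\<bar>cdf F x - cdf std_normal_distribution x\<bar> \<le> (\<integral>t. W t \<partial>lborel) / pi"
    using W_int bound by (intro real_distribution_cdf_diff_le[OF F real_dist_normal_dist]) (auto simp: has_bochner_integral_iff)
  also have "(\<integral>t. W t \<partial>lborel) =
      v1 / fact (m + 1) * (real n / q ^ (m + 1)) * (12 powr ((real m + 1) / 2) * Gamma ((real m + 1) / 2)) +
       2 * v2 / fact m * (real n / q ^ m) * (12 powr ((real (m - 1) + 1) / 2) * Gamma ((real (m - 1) + 1) / 2)) +
       b ^ (n - 1) / q * (q * B) + 1 / (T\<^sup>2 * real n) * (2 * exp (- (T * q)\<^sup>2 / 2))"
    using W_int by (rule has_bochner_integral_integral_eq)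
  also have "\<dots> / pi = C1 m * v1 / real n powr ((real m - 1) / 2) + C2 m * v2 / real n powr ((real m - 2) / 2)
    + B / pi * b ^ (n - 1) + 2 * exp (- (T\<^sup>2 * real n / 2)) / (pi * (T\<^sup>2 * real n))"
  proof -
    have n1: "real n / q ^ (m + 1) = 1 / real n powr ((real m - 1) / 2)"
      using sqrt_power_quotient[of n "m + 1"] n by (simp add: q_def)
    have n2: "real n / q ^ m = 1 / real n powr ((real m - 2) / 2)"
      using sqrt_power_quotient[of n m] n by (simp add: q_def)
    have m1: "real (m - 1) + 1 = real m" using m by simp
    have q2: "(T * q)\<^sup>2 = T\<^sup>2 * real n" by (simp add: power_mult_distrib q)
    have q3: "b ^ (n - 1) / q * (q * B) = B * b ^ (n - 1)" using q by simp
    show ?thesis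
      unfolding n1 n2 m1 q2 q3 C1_def C2_def
      by (simp add: add_divide_distrib mult_ac del: fact_Suc)
  qed
  finally show ?thesis .
qed

text \<open>Here S stands for T^2. Split S n/2 = n/2 + (S - 1) n/2; since n >= 2, the second part is
  at least S - 1, and exp(1 - S) supplies one factor v.\<close>

lemma exp_tail_le:
  fixes S v :: real
  assumes S: "1 \<le> S" and n: "2 \<le> n" and v: "0 \<le> v" "exp (1 - S) \<le> 2 * v * exp (3 / 2)"
  shows "2 * exp (- (S * real n / 2)) / (pi * (S * real n)) \<le>
    v * (4 * exp (3 / 2) / pi) * (exp (- (real n / 2)) / real n)"
proof -
  have "exp (- (S * real n / 2)) = exp ((1 - S) * (real n / 2)) * exp (- (real n / 2))"
    by (simp add: algebra_simps flip: exp_add)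
  also have "exp ((1 - S) * (real n / 2)) \<le> exp (1 - S)"
    using S n mult_left_mono_neg[of 1 "real n / 2" "1 - S"] by simp
  also have "\<dots> \<le> 2 * v * exp (3 / 2)" by (rule v)
  finally have e: "exp (- (S * real n / 2)) \<le> 2 * v * exp (3 / 2) * exp (- (real n / 2))"
    by simp
  have "2 * exp (- (S * real n / 2)) / (pi * (S * real n)) \<le> 2 * exp (- (S * real n / 2)) / (pi * real n)"
    using S n by (intro divide_left_mono mult_left_mono) auto
  also have "\<dots> \<le> 2 * (2 * v * exp (3 / 2) * exp (- (real n / 2))) / (pi * real n)"
    using e by (intro divide_right_mono mult_left_mono) auto
  finally show ?thesis by (simp add: mult_ac)
qed

theorem theorem1:
  fixes M :: "'a measure" and \<xi> :: "nat \<Rightarrow> 'a \<Rightarrow> real" and L :: "real measure"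
    and f :: "real \<Rightarrow> complex" and \<sigma> A b :: real and m n :: nat
    and \<Phi>n \<Phi> :: "real \<Rightarrow> real"
  assumes "prob_space M"
    and "m \<ge> 3"
    and "prob_space.indep_vars M (\<lambda>_. borel) \<xi> {1..}"
    and "\<And>i. i \<ge> 1 \<Longrightarrow> distr M borel (\<xi> i) = L"
    and "\<And>i. i \<ge> 1 \<Longrightarrow> integrable M (\<lambda>\<omega>. (\<xi> i \<omega>)\<^sup>2)"
    and "\<And>i. i \<ge> 1 \<Longrightarrow> prob_space.expectation M (\<xi> i) = 0"
    and "\<And>i. i \<ge> 1 \<Longrightarrow> prob_space.variance M (\<xi> i) = \<sigma>\<^sup>2"
    and "\<sigma> > 0"
    and "\<And>k. k \<in> {3..m} \<Longrightarrow> pseudomoment_exists L \<sigma> k"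
    and "f = char L"
    and "integrable lborel (\<lambda>t. cmod (f t))"
    and "A = (\<integral>t. cmod (f t) \<partial>lborel)"
    and "\<And>k. k \<in> {3..m} \<Longrightarrow> pseudomoment L \<sigma> k = 0"
    and "n \<ge> 2"
    and "nu L \<sigma> n m < 1 / 2 * exp (- (3 / 2))"
    and "\<Phi>n = cdf (distr M borel (\<lambda>\<omega>. (\<Sum>i = 1..n. \<xi> i \<omega>) / (\<sigma> * sqrt (real n))))"
    and "\<Phi> = cdf std_normal_distribution"
    and "b = exp (- (pi\<^sup>2 / (24 * A\<^sup>2 * \<sigma>\<^sup>2 * (2 + pi)\<^sup>2)))"
  shows "b < 1 \<and>
    (SUP x. \<bar>\<Phi>n x - \<Phi> x\<bar>) \<le>
      2 * C1 m * nu1 L \<sigma> n m / real n powr ((real m - 1) / 2)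
      + 2 * C2 m * nu2 L \<sigma> n m / real n powr ((real m - 2) / 2)
      + \<sigma> * A / pi * b ^ (n - 1)
      + nu L \<sigma> n m * (4 * exp (3 / 2) / pi) * (exp (- (real n / 2)) / real n)"
proof -
  interpret prob_space M by fact
  note indep = \<open>indep_vars (\<lambda>_. borel) \<xi> {1..}\<close> and law = \<open>\<And>i. i \<ge> 1 \<Longrightarrow> distr M borel (\<xi> i) = L\<close>
  note \<sigma> = \<open>\<sigma> > 0\<close> and n = \<open>n \<ge> 2\<close> and m = \<open>m \<ge> 3\<close>
  have rv: "\<xi> i \<in> borel_measurable M" if "i \<ge> 1" for i
    using indep that by (auto simp: indep_vars_def2)
  note [measurable] = rv[of 1, simplified]

  \<comment> \<open>Normalisation of the summands\<close>
  define P where "P = distr L borel (\<lambda>x. x / \<sigma>)"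
  have P_eq: "P = distr M borel (\<lambda>\<omega>. \<xi> 1 \<omega> / \<sigma>)"
    unfolding P_def by (subst law[of 1, symmetric], simp, subst distr_distr) (auto simp: comp_def)
  interpret P: real_distribution P unfolding P_eq by (rule real_distribution_distr) simp
  interpret Q: real_distribution std_normal_distribution by (rule real_dist_normal_dist)
  note PQ = P.finite_measure_axioms Q.finite_measure_axioms P.events_eq_borel Q.events_eq_borel

  have int1: "integrable M (\<xi> 1)"
    by (rule square_integrable_imp_integrable) (use assms(5)[of 1] in auto)
  have m1P: "integrable P (\<lambda>x. x)" "(\<integral>x. x \<partial>P) = 0"
    unfolding P_eq using int1 assms(6)[of 1] by (auto simp: integrable_distr_eq integral_distr)
  have m2P: "integrable P (\<lambda>x. x\<^sup>2)" "(\<integral>x. x\<^sup>2 \<partial>P) = 1"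
    unfolding P_eq using assms(5)[of 1] assms(6)[of 1] assms(7)[of 1] \<sigma>
    by (auto simp: integrable_distr_eq integral_distr power_divide)
  have charP: "char P t = f (t / \<sigma>)" for t
    unfolding P_eq \<open>f = char L\<close> law[of 1, simplified, symmetric] char_def
    by (simp add: integral_distr)

  \<comment> \<open>The rescaled integral of the characteristic function and b < 1\<close>
  define B where "B = (\<integral>t. cmod (char P t) \<partial>lborel)"
  have "has_bochner_integral lborel (\<lambda>t. cmod (f t)) A"
    using assms(11,12) by (simp add: has_bochner_integral_iff)
  then have "has_bochner_integral lborel (\<lambda>t. cmod (f (0 + 1 / \<sigma> * t))) (A /\<^sub>R \<bar>1 / \<sigma>\<bar>)"
    using \<sigma> by (subst lborel_has_bochner_integral_real_affine_iff[symmetric]) auto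
  then have intP: "integrable lborel (\<lambda>t. cmod (char P t))" and B: "B = \<sigma> * A"
    using \<sigma> by (auto simp: has_bochner_integral_iff charP B_def)
  \<comment> \<open>Positivity matters for b < 1: for B = 0 the quotient in the exponent would be 0
    and b would be 1.\<close>
  have "0 < B" unfolding B_def using m2P intP by (intro P.integral_cmod_char_pos) auto
  have b: "b = exp (- (pi\<^sup>2 / (24 * B\<^sup>2 * (2 + pi)\<^sup>2)))"
    by (simp add: assms(18) B power_mult_distrib mult_ac)
  have "0 < 2 + pi" using pi_gt_zero by linarith
  then have "0 < pi\<^sup>2 / (24 * B\<^sup>2 * (2 + pi)\<^sup>2)"
    using \<open>0 < B\<close> by (intro divide_pos_pos mult_pos_pos zero_less_power) auto
  then have "b < 1" by (simp add: b)

  \<comment> \<open>Vanishing pseudomoments and the Taylor bound\<close>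
  define pv where "pv = pos_variation borel (\<lambda>B. measure P B - measure std_normal_distribution B)"
  define nv where "nv = neg_variation borel (\<lambda>B. measure P B - measure std_normal_distribution B)"
  define tv where "tv = total_variation borel (\<lambda>B. measure P B - measure std_normal_distribution B)"
  have dH: "dH L \<sigma> = (\<lambda>B. measure P B - measure std_normal_distribution B)"
    by (auto simp: dH_def P_def)
  have tv: "abs_dH L \<sigma> = tv" by (simp add: abs_dH_def dH tv_def)
  have tvm: "integrable tv (\<lambda>x. x ^ m)"
    using assms(9)[of m] m by (simp add: pseudomoment_exists_def tv)
  then have pm: "integrable pv (\<lambda>x. x ^ m)" "integrable nv (\<lambda>x. x ^ m)"
    using integrable_total_variation_iff[OF PQ, of "\<lambda>x. x ^ m"] by (auto simp: tv_def pv_def nv_def)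
  have fin: "finite_measure pv" "finite_measure nv"
    unfolding pv_def nv_def by (rule finite_measure_pos_variation[OF PQ] finite_measure_neg_variation[OF PQ])+
  have mom: "(\<integral>x. x ^ k \<partial>pv) = (\<integral>x. x ^ k \<partial>nv)" if "k \<le> m" for k
  proof (cases "3 \<le> k")
    case True
    then show ?thesis using assms(13)[of k] that
      by (simp add: pseudomoment_def signed_integral_def dH pv_def nv_def)
  next
    \<comment> \<open>The orders 0, 1 and 2 are not among the assumed pseudomoments; they vanish
      because both laws have mass 1, mean 0 and variance 1.\<close>
    case False
    have "integrable pv (\<lambda>x. x ^ k)" "integrable nv (\<lambda>x. x ^ k)"
      using integrable_power_mono[OF that fin(1) _ pm(1)] integrable_power_mono[OF that fin(2) _ pm(2)]
      by (auto simp: pv_def nv_def)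
    moreover have k: "k = 0 \<or> k = 1 \<or> k = 2" using False by linarith
    then have "integrable P (\<lambda>x. x ^ k)" using m1P m2P by auto
    ultimately have "(\<integral>x. x ^ k \<partial>pv) - (\<integral>x. x ^ k \<partial>nv) =
        (\<integral>x. x ^ k \<partial>P) - (\<integral>x. x ^ k \<partial>std_normal_distribution)"
      unfolding pv_def nv_def
      by (intro integral_variation_diff_real[OF PQ]) (auto simp: integrable_std_normal_distribution_moment)
    moreover have "(\<integral>x. x ^ k \<partial>P) = (\<integral>x. x ^ k \<partial>std_normal_distribution)"
      using k m1P m2P integral_std_normal_distribution_moment_odd[of 1] std_normal_distribution_even_moments(1)[of 1]
        P.prob_space Q.prob_space by auto
    ultimately show ?thesis by simp
  qed
  \<comment> \<open>The free radius R of \<open>cmod_char_diff_le\<close> becomes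
    \<open>\<sigma> * sqrt (real n)\<close>, the truncation level in \<open>nu1\<close> and
    \<open>nu2\<close>.\<close>
  have diff: "cmod (char P t - char std_normal_distribution t) \<le>
      \<bar>t\<bar> ^ (m + 1) / fact (m + 1) * nu1 L \<sigma> n m + 2 * \<bar>t\<bar> ^ m / fact m * nu2 L \<sigma> n m" for t
    unfolding nu1_def nu2_def tv tv_def
    using tvm mom unfolding tv_def pv_def nv_def
    by (intro cmod_char_diff_le P.real_distribution_axioms Q.real_distribution_axioms) auto
  have nu: "0 \<le> nu1 L \<sigma> n m" "0 \<le> nu2 L \<sigma> n m"
    unfolding nu1_def nu2_def set_lebesgue_integral_def by (intro integral_nonneg_AE; simp)+

  \<comment> \<open>The law of the normalised sum\<close>
  define F where "F = distr M borel (\<lambda>\<omega>. (\<Sum>i = 1..n. \<xi> i \<omega>) / (\<sigma> * sqrt (real n)))"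
  have [measurable]: "(\<lambda>\<omega>. \<Sum>i = Suc 0..n. \<xi> i \<omega>) \<in> borel_measurable M"
    by (intro borel_measurable_sum rv) auto
  have F: "real_distribution F" unfolding F_def by (rule real_distribution_distr) simp
  have charF: "char F t = char P (t / sqrt (real n)) ^ n" for t
  proof -
    have "indep_vars (\<lambda>_. borel) \<xi> {1..n}" by (rule indep_vars_subset[OF indep]) auto
    then have "char (distr M borel (\<lambda>\<omega>. \<Sum>i = 1..n. \<xi> i \<omega>)) u = (\<Prod>i = 1..n. char (distr M borel (\<xi> i)) u)" for u
      by (rule char_distr_sum)
    then have "char (distr M borel (\<lambda>\<omega>. \<Sum>i = 1..n. \<xi> i \<omega>)) u = f u ^ n" for u
      by (simp add: law \<open>f = char L\<close>)
    moreover have "char F t = char (distr M borel (\<lambda>\<omega>. \<Sum>i = 1..n. \<xi> i \<omega>)) (t / sqrt (real n) / \<sigma>)"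
      by (simp add: F_def char_def integral_distr mult.commute)
    ultimately show ?thesis by (simp add: charP)
  qed

  \<comment> \<open>Choice of the cut-off, with S = T^2\<close>
  have main: "\<bar>\<Phi>n x - \<Phi> x\<bar> \<le>
      C1 m * nu1 L \<sigma> n m / real n powr ((real m - 1) / 2) + C2 m * nu2 L \<sigma> n m / real n powr ((real m - 2) / 2)
      + \<sigma> * A / pi * b ^ (n - 1) + 2 * exp (- (S * real n / 2)) / (pi * (S * real n))"
    if "1 \<le> S" "nu L \<sigma> n m \<le> exp (- (1 / 2) - S) / 2" for x S
    using cdf_diff_le_of_char_power[OF P.real_distribution_axioms F m2P(1) _ intP B_def b charF diff nu, of "sqrt S" x]
      that m2P n m
    by (simp add: assms(16,17) F_def B nu_def)
  have tail: "\<bar>\<Phi>n x - \<Phi> x\<bar> \<le>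
      C1 m * nu1 L \<sigma> n m / real n powr ((real m - 1) / 2) + C2 m * nu2 L \<sigma> n m / real n powr ((real m - 2) / 2)
      + \<sigma> * A / pi * b ^ (n - 1) + nu L \<sigma> n m * (4 * exp (3 / 2) / pi) * (exp (- (real n / 2)) / real n)" for x
  proof (cases "nu L \<sigma> n m = 0")
    case True
    show ?thesis
    proof (rule field_le_epsilon)
      fix \<epsilon> :: real assume \<epsilon>: "0 < \<epsilon>"
      \<comment> \<open>For nu = 0 every S >= 1 is admissible, and the Gaussian tail is at most 1/S
        <= \<epsilon>.\<close>
      define S where "S = max 1 (1 / \<epsilon>)"
      have S: "1 \<le> S" "1 / \<epsilon> \<le> S" by (auto simp: S_def)
      have "2 * exp (- (S * real n / 2)) / (pi * (S * real n)) \<le> 2 * 1 / (2 * (S * 1))"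
        using S n pi_ge_two by (intro frac_le mult_mono) auto
      also have "\<dots> \<le> \<epsilon>" using S \<epsilon> by (simp add: field_simps)
      finally show "\<bar>\<Phi>n x - \<Phi> x\<bar> \<le>
          C1 m * nu1 L \<sigma> n m / real n powr ((real m - 1) / 2) + C2 m * nu2 L \<sigma> n m / real n powr ((real m - 2) / 2)
          + \<sigma> * A / pi * b ^ (n - 1) + nu L \<sigma> n m * (4 * exp (3 / 2) / pi) * (exp (- (real n / 2)) / real n) + \<epsilon>"
        using main[of S x] S(1) True by simp
    qed
  next
    case False
    then have pos: "0 < nu L \<sigma> n m" using nu by (auto simp: nu_def max_def split: if_splits)
    \<comment> \<open>This is the largest S allowed by \<open>main\<close>: exp(-1/2 - S)/2 equals
      nu. The assumption nu < exp(-3/2)/2 is what makes S >= 1.\<close>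
    define S where "S = - ln (2 * nu L \<sigma> n m) - 1 / 2"
    have "ln (2 * nu L \<sigma> n m) < ln (exp (- (3 / 2)))"
      using pos assms(15) by (subst ln_less_cancel_iff) auto
    then have S: "1 \<le> S" by (simp add: S_def)
    have "exp (- (1 / 2) - S) = 2 * nu L \<sigma> n m"
      using pos by (simp add: S_def)
    moreover have "exp (1 - S) = exp (- (1 / 2) - S) * exp (3 / 2)"
      by (simp flip: exp_add)
    ultimately show ?thesis
      using main[of S x] exp_tail_le[OF S n, of "nu L \<sigma> n m"] S pos by simp
  qed
  \<comment> \<open>The bound \<open>tail\<close> has these terms with coefficient 1; as they are
    nonnegative, doubling them preserves the inequality.\<close>
  have C: "0 \<le> C1 m * nu1 L \<sigma> n m / real n powr ((real m - 1) / 2)" "0 \<le> C2 m * nu2 L \<sigma> n m / real n powr ((real m - 2) / 2)"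
    using nu m by (auto simp: C1_def C2_def intro!: mult_nonneg_nonneg divide_nonneg_nonneg less_imp_le[OF Gamma_real_pos])
  have "(SUP x. \<bar>\<Phi>n x - \<Phi> x\<bar>) \<le>
      2 * C1 m * nu1 L \<sigma> n m / real n powr ((real m - 1) / 2)
      + 2 * C2 m * nu2 L \<sigma> n m / real n powr ((real m - 2) / 2)
      + \<sigma> * A / pi * b ^ (n - 1)
      + nu L \<sigma> n m * (4 * exp (3 / 2) / pi) * (exp (- (real n / 2)) / real n)"
  proof (rule cSUP_least)
    fix x
    show "\<bar>\<Phi>n x - \<Phi> x\<bar> \<le> 2 * C1 m * nu1 L \<sigma> n m / real n powr ((real m - 1) / 2)
      + 2 * C2 m * nu2 L \<sigma> n m / real n powr ((real m - 2) / 2)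
      + \<sigma> * A / pi * b ^ (n - 1)
      + nu L \<sigma> n m * (4 * exp (3 / 2) / pi) * (exp (- (real n / 2)) / real n)"
      using tail[of x] C by (simp only: mult.assoc times_divide_eq_right[symmetric])
  qed simp
  with \<open>b < 1\<close> show ?thesis by blast
qed

end
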